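(* Let $\mathbb{K}$ be a field, let $m\ge 2$, and let $n_1\le n_2$ be positive integers with $n_2\ge 2$. Let $G=K_{n_1,n_2}$ be the complete bipartite graph on $[n_1+n_2]$, and let $S=\mathbb{K}[x_{ij}: i\in[m],\, j\in[n_1+n_2]]$. Then the multiplicity of $S/\mathcal{J}_{K_m,G}$ is \[ \operatorname{e}(S/\mathcal{J}_{K_m,G})=\begin{cases} 1, & \text{if } \max\{m+n_1+n_2-1,\,mn_1\}<mn_2,\\ 2, & \text{if } m+n_1+n_2-1<mn_1=mn_2,\\ 2n_2, & \text{if } mn_2<m+n_1+n_2-1,\\ 12, & \text{if } m+n_1+n_2-1=mn_1=mn_2,\\ \sum_{k\ge 0}\binom{m-1}{k}\binom{n_1+n_2-1}{k}+1, & \text{if } mn_1<m+n_1+n_2-1=mn_2. \end{cases} \]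
   Context: For a positive integer $a$, $[a]=\{1,\dots,a\}$. For a finite simple graph $H$ on the vertex set $[n]$, the generalized binomial edge ideal of $H$ is the ideal $\mathcal{J}_{K_m,H}$ of $S=\mathbb{K}[x_{ij}: i\in[m], j\in[n]]$ generated by all $2$-minors $x_{ik}x_{jl}-x_{il}x_{jk}$ with $1\le i<j\le m$ and $\{k,l\}\in E(H)$, $k<l$. The complete bipartite graph $K_{n_1,n_2}$ has vertex set $[n_1+n_2]=V_1\sqcup V_2$ with $V_1=\{1,\dots,n_1\}$, $V_2=\{n_1+1,\dots,n_1+n_2\}$, and edges all $\{u,v\}$ with $u\in V_1$, $v\in V_2$. Multiplicity is that of a standard graded $\mathbb{K}$-algebra: if $\operatorname{Hilb}(M,t)=h(t)/(1-t)^{d}$ with $d=\dim M$, then $\operatorname{e}(M)=h(1)$. Binomial coefficients $\binom{a}{k}$ with $k>a\ge 0$ are zero. *)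

theory Defs
  imports
    "HOL-Algebra.QuotRing"
    "HOL-Algebra.Embedded_Algebras"
    "HOL-Library.Poly_Mapping"
    "HOL-Library.Groups_Big_Fun"
    "HOL-Library.Extended_Nat"
    "HOL-Computational_Algebra.Polynomial_FPS"
begin

section \<open>Polynomial rings in a set of variables\<close>

text \<open>
  A polynomial maps monomials to coefficients, and a monomial maps variables to exponents;
  the ring operations are those of \<^theory>\<open>HOL-Library.Poly_Mapping\<close> (convolution product).
\<close>

type_synonym ('v, 'k) mpol = "('v \<Rightarrow>\<^sub>0 nat) \<Rightarrow>\<^sub>0 'k"

definition mpol_ring :: "'v set \<Rightarrow> ('v, 'k::field) mpol ring" where
  "mpol_ring V =
     \<lparr>carrier = {p. \<forall>t\<in>Poly_Mapping.keys p. Poly_Mapping.keys t \<subseteq> V},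
      monoid.mult = (*), monoid.one = 1, ring.zero = 0, ring.add = (+)\<rparr>"

definition mpol_var :: "'v \<Rightarrow> ('v, 'k::field) mpol" where
  "mpol_var v = Poly_Mapping.single (Poly_Mapping.single v 1) 1"

definition mpol_const :: "'k \<Rightarrow> ('v, 'k::field) mpol" where
  "mpol_const c = Poly_Mapping.single 0 c"

definition mono_degree :: "('v \<Rightarrow>\<^sub>0 nat) \<Rightarrow> nat" where
  "mono_degree t = (\<Sum>v\<in>Poly_Mapping.keys t. Poly_Mapping.lookup t v)"

definition homogeneous_part :: "'v set \<Rightarrow> nat \<Rightarrow> ('v, 'k::field) mpol set" where
  "homogeneous_part V d =
     {p \<in> carrier (mpol_ring V). \<forall>t\<in>Poly_Mapping.keys p. mono_degree t = d}"

lemma mpol_ring_cring: "cring (mpol_ring V :: ('v, 'k::field) mpol ring)"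
proof -
  let ?R = "mpol_ring V :: ('v, 'k) mpol ring"
  have add: "p + q \<in> carrier ?R" if pq: "p \<in> carrier ?R" "q \<in> carrier ?R" for p q
  proof -
    have "Poly_Mapping.keys t \<subseteq> V" if t: "t \<in> Poly_Mapping.keys (p + q)" for t
    proof -
      have "t \<in> Poly_Mapping.keys p \<or> t \<in> Poly_Mapping.keys q"
        using t Poly_Mapping.keys_add[of p q] by blast
      then show ?thesis using pq by (auto simp: mpol_ring_def)
    qed
    then show ?thesis by (simp add: mpol_ring_def)
  qed
  have mult: "p * q \<in> carrier ?R" if pq: "p \<in> carrier ?R" "q \<in> carrier ?R" for p q
  proof -
    have "Poly_Mapping.keys t \<subseteq> V" if t: "t \<in> Poly_Mapping.keys (p * q)" for t
    proof -
      obtain a b where ab: "a \<in> Poly_Mapping.keys p" "b \<in> Poly_Mapping.keys q" "t = a + b"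
        using t keys_mult[of p q] by blast
      have "Poly_Mapping.keys a \<subseteq> V" "Poly_Mapping.keys b \<subseteq> V"
        using ab(1,2) pq by (auto simp: mpol_ring_def)
      then show ?thesis
        using ab(3) Poly_Mapping.keys_add[of a b] by blast
    qed
    then show ?thesis by (simp add: mpol_ring_def)
  qed
  have neg: "- p \<in> carrier ?R" if "p \<in> carrier ?R" for p
    using that by (simp add: mpol_ring_def in_keys_iff)
  have units: "0 \<in> carrier ?R" "1 \<in> carrier ?R"
    by (simp_all add: mpol_ring_def)
  have ops [simp]: "monoid.mult ?R = (*)" "monoid.one ?R = 1" "ring.zero ?R = 0" "ring.add ?R = (+)"
    by (simp_all add: mpol_ring_def)
  have "abelian_group ?R"
  proof (rule abelian_groupI)
    fix p assume "p \<in> carrier ?R"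
    then show "\<exists>q\<in>carrier ?R. q \<oplus>\<^bsub>?R\<^esub> p = \<zero>\<^bsub>?R\<^esub>"
      using neg by (intro bexI[of _ "- p"]) simp_all
  qed (simp_all add: add units add.assoc add.commute)
  moreover have "comm_monoid ?R"
    by (rule comm_monoidI) (simp_all add: mult units mult.assoc mult.commute)
  ultimately show ?thesis
    by (rule cringI) (simp add: distrib_right)
qed


section \<open>Krull dimension and multiplicity\<close>

text \<open>The supremum of the lengths of strict chains of prime ideals (0 for the zero ring).\<close>

definition krull_dim :: "('a, 'b) ring_scheme \<Rightarrow> enat" where
  "krull_dim A =
     (SUP r \<in> {r. \<exists>P :: nat \<Rightarrow> 'a set.
                  (\<forall>i\<le>r. primeideal (P i) A) \<and> (\<forall>i<r. P i \<subset> P (Suc i))}. enat r)"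

text \<open>
  In the following, \<open>A\<close> is the graded algebra, \<open>K\<close> its coefficient field as a subset of
  \<open>carrier A\<close>, and \<open>G d\<close> its component of degree \<open>d\<close>.
\<close>

definition hilbert_function ::
    "('a, 'b) ring_scheme \<Rightarrow> 'a set \<Rightarrow> (nat \<Rightarrow> 'a set) \<Rightarrow> nat \<Rightarrow> nat" where
  "hilbert_function A K G d = (THE r. ring.dimension A r K (G d))"

definition hilbert_series ::
    "('a, 'b) ring_scheme \<Rightarrow> 'a set \<Rightarrow> (nat \<Rightarrow> 'a set) \<Rightarrow> int fps" where
  "hilbert_series A K G = Abs_fps (\<lambda>d. int (hilbert_function A K G d))"

text \<open>
  The value \<open>h 1\<close>, where the Hilbert series is \<open>h(t) / (1 - t) ^ d\<close> with \<open>d\<close> the Krull dimension.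
  As the dimension is fixed, there is at most one such polynomial \<open>h\<close>.
\<close>

definition graded_multiplicity ::
    "('a, 'b) ring_scheme \<Rightarrow> 'a set \<Rightarrow> (nat \<Rightarrow> 'a set) \<Rightarrow> int" where
  "graded_multiplicity A K G =
     (THE e. \<exists>d h. krull_dim A = enat d \<and>
                   hilbert_series A K G * (1 - fps_X) ^ d = fps_of_poly h \<and>
                   e = poly h 1)"

text \<open>
  The multiplicity of the quotient of the polynomial ring on the variables \<open>V\<close> by a homogeneous
  ideal \<open>J\<close>; field and grading are the images of the constants and of the homogeneous parts.
\<close>

definition quotient_multiplicity :: "'v set \<Rightarrow> ('v, 'k::field) mpol set \<Rightarrow> int" where
  "quotient_multiplicity V J =
     graded_multiplicity (mpol_ring V Quot J)
       (a_r_coset (mpol_ring V) J ` range mpol_const)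
       (\<lambda>d. a_r_coset (mpol_ring V) J ` homogeneous_part V d)"


section \<open>Generalized binomial edge ideals\<close>

text \<open>\<open>(i, j)\<close> stands for the variable in row \<open>i\<close> and column \<open>j\<close> of the generic \<open>m \<times> n\<close> matrix.\<close>

definition matrix_vars :: "nat \<Rightarrow> nat \<Rightarrow> (nat \<times> nat) set" where
  "matrix_vars m n = {1..m} \<times> {1..n}"

text \<open>The argument \<open>E\<close> is the edge set of a simple graph on the vertices \<open>{1..n}\<close>.\<close>

definition gen_binomial_edge_ideal ::
    "nat \<Rightarrow> nat \<Rightarrow> nat set set \<Rightarrow> (nat \<times> nat, 'k::field) mpol set" where
  "gen_binomial_edge_ideal m n E =
     Idl\<^bsub>mpol_ring (matrix_vars m n)\<^esub>
       {mpol_var (i, k) * mpol_var (j, l) - mpol_var (i, l) * mpol_var (j, k) | i j k l.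
          1 \<le> i \<and> i < j \<and> j \<le> m \<and> {k, l} \<in> E \<and> k < l}"

definition complete_bipartite_edges :: "nat \<Rightarrow> nat \<Rightarrow> nat set set" where
  "complete_bipartite_edges n1 n2 = {{u, v} | u v. u \<in> {1..n1} \<and> v \<in> {n1+1..n1+n2}}"

end

theory Submission
  imports Defs
begin

text \<open>
  The ideal is generated by differences of monomials, so the classes of monomials modulo the ideal
  form a basis of the quotient. View a monomial as an \<open>m \<times> n\<close> matrix of exponents: a generator swaps
  the rows of two units lying in columns of different parts. If both parts occur in the support, such
  swaps generate all permutations of the units, and the class is given by the row sums and the column
  sums; if only one part occurs, no swap applies. Counting the classes yields the Hilbert series
  \<open>F (m n1 - 1) 0 + F (m n2 - 1) 0 + F (m - 1) (n - 1) - F (m - 1) (n1 - 1) - F (m - 1) (n2 - 1)\<close>, where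
  \<open>n = n1 + n2\<close> and \<open>F p q = (\<Sum>d. (p + d choose d) (q + d choose d) t^d)
    = (\<Sum>k. (p choose k) (q choose k) t^k) / (1 - t)^(p + q + 1)\<close>.
  The Krull dimension is \<open>max (m n2) (m + n - 1)\<close>: a chain of primes of length \<open>r\<close> gives \<open>r\<close> elements that
  are algebraically independent modulo its first member, so \<open>r\<close> is at most the order of growth of the
  Hilbert function, and kernels of explicit substitutions give chains of that length.
\<close>

text \<open>The zero set of the ideal is a union of three pieces: two linear spaces, where the
  columns of one part vanish, of dimensions \<open>m * n2\<close> and \<open>m * n1\<close>, and the
  matrices of rank at most one, of dimension \<open>m + n1 + n2 - 1\<close>. These numbers are the
  pole orders at \<open>t = 1\<close> of the three positive terms of the Hilbert series, and the
  cases of the theorem list which of them attain the maximum. The two subtracted terms have pole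
  orders \<open>m + n1 - 1\<close> and \<open>m + n2 - 1\<close>, which stay below
  \<open>m + n1 + n2 - 1\<close>, so they never reach the multiplicity. The obstacle is the Krull
  dimension: it is defined by chains of arbitrary primes and cannot be read off the series directly.
  Counting all degrees up to \<open>d\<close> at once raises the exponent of growth by one and so
  makes it equal to the pole order; comparing this growth with the number of power products bounds
  every chain. No primary decomposition is needed, because membership in the ideal is decided by one
  linear map on classes of monomials.\<close>

section \<open>Pushing forward finitely supported functions\<close>

text \<open>The linear extension of a map of basis elements. On a polynomial it adds up the
  coefficients over each class of monomials; on an exponent matrix, with \<open>fst\<close> or
  \<open>snd\<close>, it gives the row or column sums. Both uses are why the coefficients lie in any
  commutative additive monoid.\<close>

definition push :: "('a \<Rightarrow> 'b) \<Rightarrow> ('a \<Rightarrow>\<^sub>0 'c) \<Rightarrow> 'b \<Rightarrow>\<^sub>0 'c::comm_monoid_add" where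
  "push f p = (\<Sum>t\<in>Poly_Mapping.keys p. Poly_Mapping.single (f t) (Poly_Mapping.lookup p t))"

lemma push_superset:
  assumes "finite A" "Poly_Mapping.keys p \<subseteq> A"
  shows "push f p = (\<Sum>t\<in>A. Poly_Mapping.single (f t) (Poly_Mapping.lookup p t))"
  unfolding push_def
  by (rule sum.mono_neutral_left) (use assms in \<open>auto simp: in_keys_iff\<close>)

lemma push_zero [simp]: "push f 0 = 0"
  by (simp add: push_def)

lemma push_single [simp]: "push f (Poly_Mapping.single t c) = Poly_Mapping.single (f t) c"
  by (cases "c = 0") (simp_all add: push_def)

lemma push_add: "push f (p + q) = push f p + push f q"
proof -
  let ?A = "Poly_Mapping.keys p \<union> Poly_Mapping.keys q"
  have "push f r = (\<Sum>t\<in>?A. Poly_Mapping.single (f t) (Poly_Mapping.lookup r t))"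
    if "r \<in> {p, q, p + q}" for r
    by (rule push_superset) (use that Poly_Mapping.keys_add[of p q] in auto)
  then show ?thesis
    by (simp add: lookup_add single_add sum.distrib)
qed

lemma push_sum: "push f (\<Sum>i\<in>I. g i) = (\<Sum>i\<in>I. push f (g i))"
  by (induction I rule: infinite_finite_induct) (simp_all add: push_add)

lemma push_diff: "push f (p - q) = push f p - push f (q :: _ \<Rightarrow>\<^sub>0 'c::ab_group_add)"
  by (metis add_diff_cancel diff_add_cancel push_add)

lemma push_push: "push f (push g p) = push (f \<circ> g) p"
  by (simp add: push_def[of g] push_def[of "f \<circ> g"] push_sum)

text \<open>Read from right to left, this writes a polynomial as the sum of its terms; products are
  expanded that way below.\<close>

lemma push_ident: "push (\<lambda>t. t) p = p"
  by (rule poly_mapping_eqI)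
     (simp add: push_def lookup_sum lookup_single when_def in_keys_iff)

lemma push_cong: "(\<And>t. t \<in> Poly_Mapping.keys p \<Longrightarrow> f t = g t) \<Longrightarrow> push f p = push g p"
  by (simp add: push_def)

lemma keys_push_subset: "Poly_Mapping.keys (push f p) \<subseteq> f ` Poly_Mapping.keys p"
proof -
  have "Poly_Mapping.lookup (push f p) x = 0" if "x \<notin> f ` Poly_Mapping.keys p" for x
    using that by (auto simp: push_def lookup_sum lookup_single when_def intro!: sum.neutral)
  then show ?thesis
    by (auto simp: in_keys_iff)
qed

lemma keys_add_nat: "Poly_Mapping.keys (s + t) = Poly_Mapping.keys s \<union> Poly_Mapping.keys t"
  for s t :: "'v \<Rightarrow>\<^sub>0 nat"
  by (auto simp: in_keys_iff lookup_add)

lemma lookup_push_nat: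
  "Poly_Mapping.lookup (push f p) x = (\<Sum>t | t \<in> Poly_Mapping.keys p \<and> f t = x. Poly_Mapping.lookup p t)"
  by (simp add: push_def lookup_sum lookup_single when_def sum.If_cases Int_def)

text \<open>Natural exponents cannot cancel, so the inclusion that holds for general coefficients
  becomes an equality.\<close>

lemma keys_push_nat: "Poly_Mapping.keys (push f t) = f ` Poly_Mapping.keys t" for t :: "'v \<Rightarrow>\<^sub>0 nat"
  by (auto simp: in_keys_iff lookup_push_nat)

section \<open>Total degree of monomials\<close>

lemma mono_degree_superset:
  "finite A \<Longrightarrow> Poly_Mapping.keys t \<subseteq> A \<Longrightarrow> mono_degree t = (\<Sum>v\<in>A. Poly_Mapping.lookup t v)"
  unfolding mono_degree_def by (rule sum.mono_neutral_left) (auto simp: in_keys_iff)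

lemma mono_degree_zero [simp]: "mono_degree 0 = 0"
  by (simp add: mono_degree_def)

lemma mono_degree_add: "mono_degree (s + t) = mono_degree s + mono_degree t"
proof -
  let ?A = "Poly_Mapping.keys s \<union> Poly_Mapping.keys t"
  have "mono_degree r = (\<Sum>v\<in>?A. Poly_Mapping.lookup r v)" if "r \<in> {s, t, s + t}" for r
    by (rule mono_degree_superset) (use that in \<open>auto simp: keys_add_nat\<close>)
  then show ?thesis
    by (simp add: lookup_add sum.distrib)
qed

lemma mono_degree_single [simp]: "mono_degree (Poly_Mapping.single v k) = k"
  by (simp add: mono_degree_def)

lemma mono_degree_eq_0_iff: "mono_degree t = 0 \<longleftrightarrow> t = 0"
  by (auto simp: mono_degree_def in_keys_iff intro: poly_mapping_eqI)

lemma mono_degree_sum: "mono_degree (\<Sum>i\<in>I. g i) = (\<Sum>i\<in>I. mono_degree (g i))"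
  by (induction I rule: infinite_finite_induct) (simp_all add: mono_degree_add)

lemma mono_degree_push: "mono_degree (push f t) = mono_degree t"
  by (simp add: push_def mono_degree_sum) (simp add: mono_degree_def)

lemma single_le_split:
  assumes "Poly_Mapping.lookup t v \<noteq> (0::nat)"
  obtains s where "t = Poly_Mapping.single v 1 + s"
proof
  show "t = Poly_Mapping.single v 1 + (t - Poly_Mapping.single v 1)"
    by (rule poly_mapping_eqI) (use assms in \<open>auto simp: lookup_add lookup_minus lookup_single when_def\<close>)
qed

section \<open>Homogeneous linear systems\<close>

lemma underdetermined_system:
  fixes M :: "'a \<Rightarrow> 'b \<Rightarrow> 'k::field"
  assumes "finite C" "finite I" "card C < card I"
  shows "\<exists>c. (\<exists>a\<in>I. c a \<noteq> 0) \<and> (\<forall>x\<in>C. (\<Sum>a\<in>I. c a * M a x) = 0)"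
  using assms
proof (induction C arbitrary: I M rule: finite_induct)
  case empty
  then have "I \<noteq> {}" by auto
  then show ?case by (intro exI[of _ "\<lambda>_. 1"]) auto
next
  case (insert x C)
  show ?case
  proof (cases "\<forall>a\<in>I. M a x = 0")
    case True
    have "card C < card I" using insert by simp
    from insert.IH[OF insert.prems(1) this, of M] True show ?thesis
      by auto
  next
    case False
    \<comment> \<open>Gaussian elimination with pivot \<open>a0\<close> for the equation
      \<open>x\<close>.\<close>
    then obtain a0 where a0: "a0 \<in> I" "M a0 x \<noteq> 0" by blast
    let ?I = "I - {a0}"
    have "card C < card ?I"
      using insert a0 by (simp add: card_Diff_singleton)
    with insert.IH[of ?I "\<lambda>a y. M a y - M a x / M a0 x * M a0 y"] insert.prems
    obtain c where c: "\<exists>a\<in>?I. c a \<noteq> 0"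
      "\<And>y. y \<in> C \<Longrightarrow> (\<Sum>a\<in>?I. c a * (M a y - M a x / M a0 x * M a0 y)) = 0"
      by auto
    define s where "s = (\<Sum>a\<in>?I. c a * M a x)"
    \<comment> \<open>Equation \<open>x\<close> forces this value of the eliminated unknown.\<close>
    define d where "d = c(a0 := - s / M a0 x)"
    have split: "(\<Sum>a\<in>I. d a * M a y) = (\<Sum>a\<in>?I. c a * M a y) - s / M a0 x * M a0 y" for y
    proof -
      have "(\<Sum>a\<in>I. d a * M a y) = d a0 * M a0 y + (\<Sum>a\<in>?I. d a * M a y)"
        using a0 insert.prems by (simp add: sum.remove)
      also have "(\<Sum>a\<in>?I. d a * M a y) = (\<Sum>a\<in>?I. c a * M a y)"
        by (rule sum.cong) (auto simp: d_def)
      finally show ?thesis by (simp add: d_def)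
    qed
    have "(\<Sum>a\<in>I. d a * M a y) = 0" if "y \<in> insert x C" for y
    proof (cases "y = x")
      case True
      then show ?thesis using a0 by (simp add: split s_def)
    next
      case False
      then have "y \<in> C" using that by simp
      from c(2)[OF this] have "(\<Sum>a\<in>?I. c a * M a y) = (\<Sum>a\<in>?I. c a * M a x / M a0 x * M a0 y)"
        by (simp add: right_diff_distrib sum_subtractf mult.assoc)
      also have "\<dots> = s / M a0 x * M a0 y"
        by (simp add: s_def sum_distrib_right sum_divide_distrib)
      finally show ?thesis by (simp add: split)
    qed
    moreover have "\<exists>a\<in>I. d a \<noteq> 0"
      using c(1) by (auto simp: d_def)
    ultimately show ?thesis by blast
  qed
qed

section \<open>Algebraic independence along chains of primes\<close>

lemma mpol_ring_simps [simp]: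
  "monoid.mult (mpol_ring V) = (*)" "monoid.one (mpol_ring V) = 1"
  "ring.zero (mpol_ring V) = 0" "ring.add (mpol_ring V) = (+)"
  by (simp_all add: mpol_ring_def)

lemma mem_carrier_mpol_ring:
  "p \<in> carrier (mpol_ring V) \<longleftrightarrow> (\<forall>t\<in>Poly_Mapping.keys p. Poly_Mapping.keys t \<subseteq> V)"
  by (simp add: mpol_ring_def)

lemma ideal_mpol_ringD:
  assumes "ideal I (mpol_ring V :: ('v, 'k::field) mpol ring)"
  shows "I \<subseteq> carrier (mpol_ring V)" "0 \<in> I"
    "\<And>a b. a \<in> I \<Longrightarrow> b \<in> I \<Longrightarrow> a + b \<in> I"
    "\<And>a x. a \<in> I \<Longrightarrow> x \<in> carrier (mpol_ring V) \<Longrightarrow> x * a \<in> I"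
    "\<And>a x. a \<in> I \<Longrightarrow> x \<in> carrier (mpol_ring V) \<Longrightarrow> a * x \<in> I"
proof -
  interpret ideal I "mpol_ring V :: ('v, 'k) mpol ring" by fact
  show "I \<subseteq> carrier (mpol_ring V)" using a_subset by simp
  show "0 \<in> I" using additive_subgroup.zero_closed[OF additive_subgroup_axioms] by simp
  show "a + b \<in> I" if "a \<in> I" "b \<in> I" for a b
    using additive_subgroup.a_closed[OF additive_subgroup_axioms that] by simp
  show "x * a \<in> I" "a * x \<in> I" if "a \<in> I" "x \<in> carrier (mpol_ring V)" for a x
    using I_l_closed[OF that] I_r_closed[OF that] by simp_all
qed

lemma carrier_mpol_ring_closed:
  fixes p q :: "('v, 'k::field) mpol"
  assumes "p \<in> carrier (mpol_ring V)" "q \<in> carrier (mpol_ring V)"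
  shows "p + q \<in> carrier (mpol_ring V)" "p * q \<in> carrier (mpol_ring V)"
    "- p \<in> carrier (mpol_ring V)" "p - q \<in> carrier (mpol_ring V)"
proof -
  interpret cring "mpol_ring V :: ('v, 'k) mpol ring" by (rule mpol_ring_cring)
  show "p + q \<in> carrier (mpol_ring V)" "p * q \<in> carrier (mpol_ring V)"
    using assms add.m_closed m_closed by simp_all
  have neg: "- r \<in> carrier (mpol_ring V)" if "r \<in> carrier (mpol_ring V)" for r :: "('v, 'k) mpol"
    using that by (simp add: mem_carrier_mpol_ring in_keys_iff)
  show "- p \<in> carrier (mpol_ring V)" using neg assms by simp
  show "p - q \<in> carrier (mpol_ring V)"
    using add.m_closed[OF assms(1) neg[OF assms(2)]] by simp
qed

lemma carrier_mpol_ring_zero_one [simp]: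
  "0 \<in> carrier (mpol_ring V)" "1 \<in> carrier (mpol_ring V)"
  by (simp_all add: mem_carrier_mpol_ring)

lemma mpol_const_in_carrier [simp]: "mpol_const c \<in> carrier (mpol_ring V)"
  by (simp add: mem_carrier_mpol_ring mpol_const_def)

lemma monomial_in_carrier:
  "Poly_Mapping.keys t \<subseteq> V \<Longrightarrow> Poly_Mapping.single t c \<in> carrier (mpol_ring V)"
  by (simp add: mem_carrier_mpol_ring)

lemma mpol_var_in_carrier: "v \<in> V \<Longrightarrow> mpol_var v \<in> carrier (mpol_ring V)"
  by (simp add: mpol_var_def monomial_in_carrier)

lemma carrier_mpol_ring_sum:
  "(\<And>i. i \<in> I \<Longrightarrow> g i \<in> carrier (mpol_ring V)) \<Longrightarrow> (\<Sum>i\<in>I. g i) \<in> carrier (mpol_ring V)"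
  by (induction I rule: infinite_finite_induct) (simp_all add: carrier_mpol_ring_closed)

lemma carrier_mpol_ring_power:
  "p \<in> carrier (mpol_ring V) \<Longrightarrow> p ^ k \<in> carrier (mpol_ring V)"
  by (induction k) (simp_all add: carrier_mpol_ring_closed)

lemma mpol_const_simps:
  "mpol_const 0 = 0" "mpol_const 1 = 1" "mpol_const (a + b) = mpol_const a + mpol_const b"
  "mpol_const (a * b) = mpol_const a * mpol_const b"
  by (simp_all add: mpol_const_def single_add mult_single)

lemma lookup_mpol_const_mult: "Poly_Mapping.lookup (mpol_const c * p) t = c * Poly_Mapping.lookup p t"
  unfolding mpol_const_def by (subst mult_map_scale_conv_mult[symmetric]) (simp add: Poly_Mapping.map.rep_eq when_def)

lemma lookup_push_mpol_const_mult:
  "Poly_Mapping.lookup (push f (mpol_const c * p)) x = c * Poly_Mapping.lookup (push f p) x"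
proof -
  have "push f (mpol_const c * p) =
      (\<Sum>t\<in>Poly_Mapping.keys p. Poly_Mapping.single (f t) (Poly_Mapping.lookup (mpol_const c * p) t))"
    by (rule push_superset) (auto simp: in_keys_iff lookup_mpol_const_mult)
  then show ?thesis
    by (simp add: lookup_mpol_const_mult push_def lookup_sum lookup_single when_def sum_distrib_left
        if_distrib cong: if_cong)
qed

section \<open>Degree bounds for products of powers\<close>

definition degree_le :: "nat \<Rightarrow> ('v, 'k::field) mpol \<Rightarrow> bool" where
  "degree_le d p \<longleftrightarrow> (\<forall>t\<in>Poly_Mapping.keys p. mono_degree t \<le> d)"

lemma degree_le_one: "degree_le d 1"
  by (simp add: degree_le_def)

lemma degree_le_mult: "degree_le d p \<Longrightarrow> degree_le e q \<Longrightarrow> degree_le (d + e) (p * q)"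
  unfolding degree_le_def using keys_mult[of p q] by (force simp: mono_degree_add intro: add_mono)

lemma degree_le_power: "degree_le d p \<Longrightarrow> degree_le (k * d) (p ^ k)"
  by (induction k) (simp_all add: degree_le_one degree_le_mult)

lemma degree_le_mono: "degree_le d p \<Longrightarrow> d \<le> e \<Longrightarrow> degree_le e p"
  unfolding degree_le_def by (meson le_trans)

lemma degree_le_exists: "\<exists>d. degree_le d p"
  unfolding degree_le_def by (meson finite_keys finite_nat_set_iff_bounded_le finite_imageI imageI)

text \<open>Modulo \<open>Q\<close> only \<open>h 0\<close> is left of the sum, because
  \<open>p\<close> lies in \<open>Q\<close>; so \<open>h 0\<close> vanishes. The rest is
  \<open>p\<close> times a shorter combination, and \<open>p\<close> can be cancelled since
  \<open>P\<close> is prime and does not contain it.\<close>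

lemma power_combination_mem:
  fixes p :: "('v, 'k::field) mpol"
  assumes P: "primeideal P (mpol_ring V)" and Q: "primeideal Q (mpol_ring V)"
    and "P \<subseteq> Q" "p \<in> Q" "p \<notin> P"
    and "\<And>j. h j \<in> carrier (mpol_ring V)" "\<And>j. j \<le> k \<Longrightarrow> h j \<in> Q \<Longrightarrow> h j = 0"
    and "(\<Sum>j\<le>k. p ^ j * h j) \<in> P" and "j \<le> k"
  shows "h j = 0"
  using assms(6-9)
proof (induction k arbitrary: h j)
  case 0
  then show ?case using assms(3) by auto
next
  case (Suc k)
  interpret P: primeideal P "mpol_ring V" by fact
  interpret Q: primeideal Q "mpol_ring V" by fact
  note Qi = ideal_mpol_ringD[OF Q.is_ideal]
  define s where "s = (\<Sum>j\<le>k. p ^ j * h (Suc j))"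
  have p: "p \<in> carrier (mpol_ring V)" using assms(4) Qi(1) by blast
  have s: "s \<in> carrier (mpol_ring V)"
    unfolding s_def using p Suc.prems(1)
    by (intro carrier_mpol_ring_sum carrier_mpol_ring_closed carrier_mpol_ring_power) auto
  have sum: "(\<Sum>j\<le>Suc k. p ^ j * h j) = h 0 + p * s"
    by (subst sum.atMost_Suc_shift) (simp add: s_def sum_distrib_left mult.assoc)
  have "- (p * s) \<in> Q"
    using Qi(5)[OF assms(4) carrier_mpol_ring_closed(3)[OF s s]] by simp
  then have "(h 0 + p * s) + - (p * s) \<in> Q"
    using Qi(3) Suc.prems(3) assms(3) by (metis sum subsetD)
  then have h0: "h 0 = 0" using Suc.prems(2)[of 0] by simp
  then have "p * s \<in> P" using Suc.prems(3) sum by simp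
  then have "s \<in> P"
    using P.I_prime[OF p s] assms(5) by auto
  then have "h (Suc j) = 0" if "j \<le> k" for j
    using Suc.IH[of "\<lambda>j. h (Suc j)" j] Suc.prems(1,2) that by (auto simp: s_def)
  then show ?case using h0 Suc.prems(4) by (cases j) auto
qed

text \<open>The offset \<open>s\<close> lets an induction drop the first exponent and continue with
  the tail of a chain of primes that starts at \<open>P (Suc s)\<close>.\<close>

fun power_prod :: "(nat \<Rightarrow> 'a::comm_monoid_mult) \<Rightarrow> nat \<Rightarrow> nat list \<Rightarrow> 'a" where
  "power_prod f s [] = 1"
| "power_prod f s (j # js) = f s ^ j * power_prod f (Suc s) js"

lemma power_prod_in_carrier:
  "(\<And>i. i < s + length js \<Longrightarrow> f i \<in> carrier (mpol_ring V)) \<Longrightarrow> power_prod f s js \<in> carrier (mpol_ring V)"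
  by (induction js arbitrary: s)
     (auto intro!: carrier_mpol_ring_closed carrier_mpol_ring_power)

lemma degree_le_power_prod:
  assumes "\<And>i. i < s + length js \<Longrightarrow> degree_le e (f i)" "set js \<subseteq> {..k}"
  shows "degree_le (length js * k * e) (power_prod f s js)"
  using assms
proof (induction js arbitrary: s)
  case Nil
  then show ?case by (simp add: degree_le_one)
next
  case (Cons j js)
  have "degree_le (k * e) (f s ^ j)"
    by (rule degree_le_mono[OF degree_le_power[of e]]) (use Cons.prems in auto)
  moreover have "degree_le (length js * k * e) (power_prod f (Suc s) js)"
    by (rule Cons.IH) (use Cons.prems in auto)
  ultimately show ?case
    using degree_le_mult by (fastforce simp: algebra_simps)
qed

lemma lists_length_Suc:
  "{js. length js = Suc n \<and> set js \<subseteq> A} = (\<lambda>(j, js). j # js) ` (A \<times> {js. length js = n \<and> set js \<subseteq> A})"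
  by (auto simp: length_Suc_conv image_iff)

text \<open>Choosing \<open>f i \<in> P (i + 1) - P i\<close> along a chain of primes yields elements that are
  algebraically independent modulo \<open>P 0\<close>.\<close>

lemma prime_chain_independent:
  fixes f :: "nat \<Rightarrow> ('v, 'k::field) mpol"
  assumes prime: "\<And>i. i \<le> s + n \<Longrightarrow> primeideal (P i) (mpol_ring V)"
    and sub: "\<And>i. i < s + n \<Longrightarrow> P i \<subseteq> P (Suc i)"
    and f: "\<And>i. i < s + n \<Longrightarrow> f i \<in> P (Suc i) - P i"
    and mem: "(\<Sum>js | length js = n \<and> set js \<subseteq> {..k}. mpol_const (c js) * power_prod f s js) \<in> P s"
    and js: "length js = n" "set js \<subseteq> {..k}"
  shows "c js = 0"
  using assms
proof (induction n arbitrary: s c js)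
  case 0
  interpret primeideal "P s" "mpol_ring V" using 0 by simp
  have "{js. js = [] \<and> set js \<subseteq> {..k}} = {[]}" by auto
  then have const: "mpol_const (c []) \<in> P s" using "0.prems"(4) by simp
  \<comment> \<open>A nonzero constant would be a unit inside a proper ideal.\<close>
  have "c [] = 0"
  proof (rule ccontr)
    assume "c [] \<noteq> 0"
    then have "1 = mpol_const (1 / c []) * (mpol_const (c []) :: ('v, 'k) mpol)"
      by (simp flip: mpol_const_simps)
    then have "1 \<in> P s"
      using ideal_mpol_ringD(4)[OF is_ideal const, of "mpol_const (1 / c [])"] by simp
    then show False using one_imp_carrier I_notcarr by simp
  qed
  then show ?case using 0 by simp
next
  case (Suc n)
  let ?L = "{js. length js = n \<and> set js \<subseteq> {..k}}"
  \<comment> \<open>\<open>h j\<close> is the coefficient of \<open>f s ^ j\<close>. It involves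
    only later elements of the chain, so the induction hypothesis applies to it modulo
    \<open>P (Suc s)\<close>.\<close>
  define h where "h j = (\<Sum>js\<in>?L. mpol_const (c (j # js)) * power_prod f (Suc s) js)" for j
  have carr: "f i \<in> carrier (mpol_ring V)" if "i < s + Suc n" for i
    using Suc.prems(3)[OF that] ideal_mpol_ringD(1)[OF primeideal.axioms(1)[OF Suc.prems(1)[of "Suc i"]]] that
    by auto
  have "h j \<in> carrier (mpol_ring V)" for j
    unfolding h_def
    by (intro carrier_mpol_ring_sum carrier_mpol_ring_closed mpol_const_in_carrier power_prod_in_carrier carr) auto
  moreover have zero: "c (j # js) = 0" if "h j \<in> P (Suc s)" "js \<in> ?L" for j js
    by (rule Suc.IH[of "Suc s" "\<lambda>js. c (j # js)" js]) (use Suc.prems that in \<open>auto simp: h_def\<close>)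
  then have "h j = 0" if "h j \<in> P (Suc s)" for j
    using that by (simp add: h_def mpol_const_simps)
  moreover have "(\<Sum>js | length js = Suc n \<and> set js \<subseteq> {..k}. mpol_const (c js) * power_prod f s js)
      = (\<Sum>j\<le>k. f s ^ j * h j)"
    unfolding lists_length_Suc h_def sum_distrib_left
    by (subst sum.reindex) (auto simp: inj_on_def sum.cartesian_product ac_simps intro!: sum.cong)
  moreover obtain j js' where "js = j # js'" "j \<le> k" "js' \<in> ?L"
    using Suc.prems(5,6) by (cases js) auto
  ultimately show ?case
    using power_combination_mem[of "P s" V "P (Suc s)" "f s" h k j] zero[of j js'] Suc.prems(1-4)
      ideal_mpol_ringD(2)[OF primeideal.axioms(1)[OF Suc.prems(1)[of "Suc s"]]]
    by auto
qed

text \<open>A polynomial of degree \<open>r\<close> in \<open>k\<close> cannot stay below one of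
  degree \<open>D < r\<close>; a single large \<open>k\<close> already refutes the
  inequality.\<close>

lemma power_growth_exponent_le:
  fixes r C a D :: nat
  assumes "\<And>k. (k + 1) ^ r \<le> C * (a * k + 1) ^ D"
  shows "r \<le> D"
proof (rule ccontr)
  assume "\<not> r \<le> D"
  \<comment> \<open>With \<open>k = B\<close> the right side is at most
    \<open>B * (B + 1) ^ D\<close>, while the left side is at least
    \<open>(B + 1) ^ Suc D\<close>.\<close>
  define B where "B = C * (a + 1) ^ D"
  have "(B + 1) ^ D * (B + 1) \<le> (B + 1) ^ r"
    using \<open>\<not> r \<le> D\<close> power_increasing[of "Suc D" r "B + 1"] by (simp add: ac_simps)
  also have "\<dots> \<le> C * (a * B + 1) ^ D" by (rule assms)
  also have "\<dots> \<le> C * ((a + 1) * (B + 1)) ^ D"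
    by (intro mult_left_mono power_mono) auto
  also have "\<dots> = (B + 1) ^ D * (C * (a + 1) ^ D)"
    by (simp only: power_mult_distrib ac_simps)
  also have "C * (a + 1) ^ D = B" by (simp only: B_def)
  finally show False by simp
qed

text \<open>There are \<open>(k + 1) ^ r\<close> products of powers of the \<open>f i\<close> with exponents at most \<open>k\<close>, and their
  degree is \<open>O(k)\<close>, so their number is at most the dimension of the quotient in degree \<open>O(k)\<close>.\<close>

lemma prime_chain_length_le:
  fixes P :: "nat \<Rightarrow> ('v, 'k::field) mpol set"
    and \<phi> :: "('v \<Rightarrow>\<^sub>0 nat) \<Rightarrow> 'b"
  assumes "finite V"
    and prime: "\<And>i. i \<le> r \<Longrightarrow> primeideal (P i) (mpol_ring V)"
    and strict: "\<And>i. i < r \<Longrightarrow> P i \<subset> P (Suc i)"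
    and ker: "\<And>p. p \<in> carrier (mpol_ring V) \<Longrightarrow> push \<phi> p = 0 \<Longrightarrow> p \<in> P 0"
    and fin: "\<And>d. finite {t. Poly_Mapping.keys t \<subseteq> V \<and> mono_degree t \<le> d}"
    and growth: "\<And>d. card (\<phi> ` {t. Poly_Mapping.keys t \<subseteq> V \<and> mono_degree t \<le> d}) \<le> C * (d + 1) ^ D"
  shows "r \<le> D"
proof -
  have "\<forall>i. \<exists>p. i < r \<longrightarrow> p \<in> P (Suc i) - P i" using strict by blast
  then obtain f where f: "\<And>i. i < r \<Longrightarrow> f i \<in> P (Suc i) - P i" by metis
  have "\<forall>i. \<exists>d. degree_le d (f i)" using degree_le_exists by blast
  then obtain deg where deg: "\<And>i. degree_le (deg i) (f i)" by metis
  define e where "e = (\<Sum>i<r. deg i)"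
  have e: "degree_le e (f i)" if "i < r" for i
    by (rule degree_le_mono[OF deg]) (use that in \<open>auto simp: e_def intro: member_le_sum\<close>)
  have carr: "f i \<in> carrier (mpol_ring V)" if "i < r" for i
    using f[OF that] ideal_mpol_ringD(1)[OF primeideal.axioms(1)[OF prime[of "Suc i"]]] that by auto
  have "(k + 1) ^ r \<le> C * ((r * e) * k + 1) ^ D" for k
  proof (rule ccontr)
    assume less: "\<not> ?thesis"
    let ?L = "{js. length js = r \<and> set js \<subseteq> {..k}}"
    let ?M = "{t. Poly_Mapping.keys t \<subseteq> V \<and> mono_degree t \<le> r * k * e}"
    have L: "finite ?L" "card ?L = (k + 1) ^ r"
      using finite_lists_length_eq[of "{..k}" r] card_lists_length_eq[of "{..k}" r]
      by (simp_all add: conj_commute)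
    have "card (\<phi> ` ?M) < card ?L"
      using growth[of "r * k * e"] less L(2) by (simp add: ac_simps)
    \<comment> \<open>One unknown for each exponent vector, one equation for each class of monomials
      of degree at most \<open>r * k * e\<close>. A nontrivial solution is a polynomial relation
      between the \<open>f i\<close> that holds modulo \<open>P 0\<close>.\<close>
    from underdetermined_system[OF _ L(1) this,
        where M = "\<lambda>js x. Poly_Mapping.lookup (push \<phi> (power_prod f 0 js)) x"] fin
    obtain c where c: "\<exists>js\<in>?L. c js \<noteq> 0"
      "\<And>x. x \<in> \<phi> ` ?M \<Longrightarrow> (\<Sum>js\<in>?L. c js * Poly_Mapping.lookup (push \<phi> (power_prod f 0 js)) x) = 0"
      by auto
    define p where "p = (\<Sum>js\<in>?L. mpol_const (c js) * power_prod f 0 js)"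
    have pp_carr: "power_prod f 0 js \<in> carrier (mpol_ring V)" if "js \<in> ?L" for js
      by (rule power_prod_in_carrier) (use that carr in auto)
    have "Poly_Mapping.lookup (push \<phi> p) x = 0" for x
    proof -
      have eq: "Poly_Mapping.lookup (push \<phi> p) x
          = (\<Sum>js\<in>?L. c js * Poly_Mapping.lookup (push \<phi> (power_prod f 0 js)) x)"
        by (simp add: p_def push_sum lookup_sum lookup_push_mpol_const_mult)
      show ?thesis
      proof (cases "x \<in> \<phi> ` ?M")
        case True
        then show ?thesis using c(2) eq by simp
      next
        case False
        have "Poly_Mapping.lookup (push \<phi> (power_prod f 0 js)) x = 0" if js: "js \<in> ?L" for js
        proof (rule ccontr)
          assume "\<not> ?thesis"
          then have "x \<in> \<phi> ` Poly_Mapping.keys (power_prod f 0 js)"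
            using keys_push_subset by (metis in_keys_iff subsetD)
          moreover have "degree_le (r * k * e) (power_prod f 0 js)"
            using degree_le_power_prod[of 0 js e f k] js e by auto
          ultimately show False
            using False pp_carr[OF js] by (auto simp: degree_le_def mem_carrier_mpol_ring)
        qed
        then show ?thesis using eq by simp
      qed
    qed
    then have "push \<phi> p = 0" by (simp add: poly_mapping_eqI)
    moreover have "p \<in> carrier (mpol_ring V)"
      unfolding p_def by (intro carrier_mpol_ring_sum carrier_mpol_ring_closed pp_carr) auto
    ultimately have "p \<in> P 0" by (rule ker[rotated])
    then have "c js = 0" if "js \<in> ?L" for js
      using prime_chain_independent[where s = 0 and n = r and P = P and f = f and V = V and k = k and c = c and js = js] that prime strict f by (auto simp: p_def)
    then show False using c(1) by blast
  qed
  then show ?thesis by (rule power_growth_exponent_le)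
qed

section \<open>Krull dimension of quotients\<close>

text \<open>One direction of the correspondence between the primes above \<open>J\<close> and the
  primes of the quotient; the second statement carries strict inclusions over.\<close>

lemma (in cring) primeideal_quot_image:
  assumes J: "ideal J R" and Q: "primeideal Q R" and "J \<subseteq> Q"
  shows "primeideal ((+>) J ` Q) (R Quot J)" and "\<And>x. x \<in> carrier R \<Longrightarrow> J +> x \<in> (+>) J ` Q \<longleftrightarrow> x \<in> Q"
proof -
  interpret Q: primeideal Q R by fact
  interpret J: ideal J R by fact
  have id: "ideal ((+>) J ` Q) (R Quot J)"
    using ring_ideal_imp_quot_ideal[OF J Q.is_ideal] .
  have sub: "(+>) J ` Q \<subseteq> carrier (R Quot J)"
    using additive_subgroup.a_subset[OF ideal.axioms(1)[OF id]] .
  have un: "\<Union> ((+>) J ` Q) = Q"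
    using ideal_incl_iff[OF J Q.is_ideal] \<open>J \<subseteq> Q\<close> by simp
  show iff: "J +> x \<in> (+>) J ` Q \<longleftrightarrow> x \<in> Q" if "x \<in> carrier R" for x
    using canonical_proj_vimage_mem_iff[OF J sub that] un by simp
  show "primeideal ((+>) J ` Q) (R Quot J)"
  proof (rule primeidealI[OF id J.quotient_is_cring[OF is_cring]])
    have "\<one> \<notin> Q" using Q.one_imp_carrier Q.I_notcarr by auto
    then have "J +> \<one> \<notin> (+>) J ` Q" using iff by simp
    moreover have "J +> \<one> \<in> carrier (R Quot J)"
      by (rule ring_hom_closed[OF J.rcos_ring_hom one_closed])
    ultimately show "carrier (R Quot J) \<noteq> (+>) J ` Q" by metis
  next
    fix a b assume ab: "a \<in> carrier (R Quot J)" "b \<in> carrier (R Quot J)" "a \<otimes>\<^bsub>R Quot J\<^esub> b \<in> (+>) J ` Q"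
    obtain x y where xy: "x \<in> carrier R" "y \<in> carrier R" "a = J +> x" "b = J +> y"
      using ab(1,2) by (auto simp: FactRing_def A_RCOSETS_def')
    then have "a \<otimes>\<^bsub>R Quot J\<^esub> b = J +> (x \<otimes> y)"
      using ring_hom_mult[OF J.rcos_ring_hom xy(1,2)] by simp
    then have "x \<otimes> y \<in> Q" using iff[of "x \<otimes> y"] xy ab(3) by simp
    then show "a \<in> (+>) J ` Q \<or> b \<in> (+>) J ` Q"
      using Q.I_prime[OF xy(1,2)] xy by blast
  qed
qed

text \<open>Moves the computation of the dimension to chains of primes of \<open>R\<close> above
  \<open>J\<close>, so that no later argument has to handle cosets.\<close>

lemma (in cring) krull_dim_quotient_eqI:
  assumes J: "ideal J R"
    and upper: "\<And>(P :: nat \<Rightarrow> 'a set) r. (\<And>i. i \<le> r \<Longrightarrow> primeideal (P i) R) \<Longrightarrow>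
      (\<And>i. i < r \<Longrightarrow> P i \<subset> P (Suc i)) \<Longrightarrow> J \<subseteq> P 0 \<Longrightarrow> r \<le> D"
    and Q: "\<And>i. i \<le> D \<Longrightarrow> primeideal (Q i) R" "\<And>i. i < D \<Longrightarrow> Q i \<subset> Q (Suc i)" "J \<subseteq> Q 0"
  shows "krull_dim (R Quot J) = enat D"
proof -
  interpret J: ideal J R by fact
  let ?A = "R Quot J"
  let ?S = "{r. \<exists>P :: nat \<Rightarrow> 'a set set. (\<forall>i\<le>r. primeideal (P i) ?A) \<and> (\<forall>i<r. P i \<subset> P (Suc i))}"
  have "r \<le> D" if "r \<in> ?S" for r
  proof -
    from that obtain P :: "nat \<Rightarrow> 'a set set"
      where "\<forall>i\<le>r. primeideal (P i) ?A" "\<forall>i<r. P i \<subset> P (Suc i)"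
      by blast
    then have P: "\<And>i. i \<le> r \<Longrightarrow> primeideal (P i) ?A" "\<And>i. i < r \<Longrightarrow> P i \<subset> P (Suc i)"
      by blast+
    \<comment> \<open>Chains of the quotient are pulled back along the projection. Its surjectivity
      keeps the inclusions strict.\<close>
    define P' where "P' i = {x \<in> carrier R. J +> x \<in> P i}" for i
    have "primeideal (P' i) R" if "i \<le> r" for i
      unfolding P'_def
      using ring_hom_ring.primeideal_vimage[OF J.rcos_ring_hom_ring is_cring P(1)[OF that]] .
    moreover have "P' i \<subset> P' (Suc i)" if i: "i < r" for i
    proof -
      obtain a where a: "a \<in> P (Suc i)" "a \<notin> P i" using P(2)[OF i] by blast
      have "a \<in> carrier ?A"
        using a(1) P(1)[of "Suc i"] i
        by (meson Suc_leI additive_subgroup.a_Hcarr ideal.axioms(1) primeideal.axioms(1))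
      then obtain x where "x \<in> carrier R" "a = J +> x"
        by (auto simp: FactRing_def A_RCOSETS_def')
      then have "x \<in> P' (Suc i) - P' i" using a by (simp add: P'_def)
      moreover have "P' i \<subseteq> P' (Suc i)" using P(2)[OF i] by (auto simp: P'_def)
      ultimately show ?thesis by blast
    qed
    moreover have "J \<subseteq> P' 0"
    proof
      fix x assume x: "x \<in> J"
      then have "J +> x = \<zero>\<^bsub>?A\<^esub>"
        using J.a_rcos_const by (simp add: FactRing_def)
      moreover have "\<zero>\<^bsub>?A\<^esub> \<in> P 0"
        using P(1)[of 0] by (simp add: additive_subgroup.zero_closed ideal.axioms(1) primeideal.axioms(1))
      ultimately show "x \<in> P' 0" using x by (simp add: P'_def)
    qed
    ultimately show ?thesis using upper by blast
  qed
  moreover have "D \<in> ?S"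
  proof -
    have "J \<subseteq> Q i" if "i \<le> D" for i
      using that
    proof (induction i)
      case 0 then show ?case using Q by simp
    next
      case (Suc i) then show ?case using Q(2)[of i] by auto
    qed
    note * = primeideal_quot_image[OF J Q(1) this]
    have "(+>) J ` Q i \<subset> (+>) J ` Q (Suc i)" if i: "i < D" for i
    proof -
      obtain x where x: "x \<in> Q (Suc i)" "x \<notin> Q i" using Q(2)[OF i] by blast
      have "x \<in> carrier R"
        using x(1) Q(1)[of "Suc i"] i
        by (meson Suc_leI additive_subgroup.a_Hcarr ideal.axioms(1) primeideal.axioms(1))
      then have "J +> x \<in> (+>) J ` Q (Suc i)" "J +> x \<notin> (+>) J ` Q i"
        using *(2)[of i x] *(2)[of "Suc i" x] x i by auto
      then show ?thesis using Q(2)[OF i] by blast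
    qed
    then show ?thesis using *(1) by (intro CollectI exI[of _ "\<lambda>i. (+>) J ` Q i"]) auto
  qed
  ultimately show ?thesis
    unfolding krull_dim_def by (intro antisym SUP_least SUP_upper2[of D]) auto
qed

section \<open>Substitution homomorphisms and their kernels\<close>

lemma ideal_mpol_ringI:
  fixes I :: "('v, 'k::field) mpol set"
  assumes "I \<subseteq> carrier (mpol_ring V)" "0 \<in> I"
    "\<And>a b. a \<in> I \<Longrightarrow> b \<in> I \<Longrightarrow> a + b \<in> I"
    "\<And>a x. a \<in> I \<Longrightarrow> x \<in> carrier (mpol_ring V) \<Longrightarrow> x * a \<in> I"
  shows "ideal I (mpol_ring V)"
proof -
  interpret cring "mpol_ring V :: ('v, 'k) mpol ring" by (rule mpol_ring_cring)
  show ?thesis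
  proof (rule idealI)
    show "subgroup I (add_monoid (mpol_ring V))"
    proof (rule add.subgroupI)
      fix a assume a: "a \<in> I"
      then have "- a \<in> I"
        using assms(4)[of a "- 1"] carrier_mpol_ring_closed(3)[of 1 V 1] by simp
      moreover have "\<ominus>\<^bsub>mpol_ring V\<^esub> a = - a"
        using a assms(1) by (intro minus_equality) (auto simp: carrier_mpol_ring_closed)
      ultimately show "\<ominus>\<^bsub>mpol_ring V\<^esub> a \<in> I" by simp
    qed (use assms in auto)
    show "a \<otimes>\<^bsub>mpol_ring V\<^esub> x \<in> I" if "a \<in> I" "x \<in> carrier (mpol_ring V)" for a x
      using assms(4)[OF that] by (simp add: mult.commute)
  qed (use assms in \<open>auto simp: local.ring_axioms\<close>)
qed

lemma primeideal_kernel: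
  fixes h :: "('v, 'k::field) mpol \<Rightarrow> 'b::idom"
  assumes add: "\<And>p q. h (p + q) = h p + h q" and mult: "\<And>p q. h (p * q) = h p * h q"
    and one: "h 1 = 1"
  shows "primeideal {p \<in> carrier (mpol_ring V). h p = 0} (mpol_ring V)"
proof (rule primeidealI)
  have "h 0 = 0" by (metis add add.right_neutral add_left_cancel)
  then show "ideal {p \<in> carrier (mpol_ring V). h p = 0} (mpol_ring V)"
    by (intro ideal_mpol_ringI) (auto simp: carrier_mpol_ring_closed add mult)
  show "carrier (mpol_ring V) \<noteq> {p \<in> carrier (mpol_ring V). h p = 0}"
    using one carrier_mpol_ring_zero_one(2) by (metis (mono_tags, lifting) mem_Collect_eq zero_neq_one)
qed (auto simp: mult mpol_ring_cring)

definition subst_monomial :: "('v \<Rightarrow> 'a::comm_semiring_1) \<Rightarrow> ('v \<Rightarrow>\<^sub>0 nat) \<Rightarrow> 'a" where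
  "subst_monomial a t = (\<Prod>v\<in>Poly_Mapping.keys t. a v ^ Poly_Mapping.lookup t v)"

definition mpol_subst :: "('v \<Rightarrow> ('w, 'k) mpol) \<Rightarrow> ('v, 'k) mpol \<Rightarrow> ('w, 'k::field) mpol" where
  "mpol_subst a p = (\<Sum>t\<in>Poly_Mapping.keys p. mpol_const (Poly_Mapping.lookup p t) * subst_monomial a t)"

lemma subst_monomial_superset:
  "finite A \<Longrightarrow> Poly_Mapping.keys t \<subseteq> A \<Longrightarrow> subst_monomial a t = (\<Prod>v\<in>A. a v ^ Poly_Mapping.lookup t v)"
  unfolding subst_monomial_def by (rule prod.mono_neutral_left) (auto simp: in_keys_iff)

lemma subst_monomial_add: "subst_monomial a (s + t) = subst_monomial a s * subst_monomial a t"
proof -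
  let ?A = "Poly_Mapping.keys s \<union> Poly_Mapping.keys t"
  have "subst_monomial a r = (\<Prod>v\<in>?A. a v ^ Poly_Mapping.lookup r v)" if "r \<in> {s, t, s + t}" for r
    by (rule subst_monomial_superset) (use that in \<open>auto simp: keys_add_nat\<close>)
  then show ?thesis by (simp add: lookup_add power_add prod.distrib)
qed

lemma mpol_subst_superset:
  assumes "finite A" "Poly_Mapping.keys p \<subseteq> A"
  shows "mpol_subst a p = (\<Sum>t\<in>A. mpol_const (Poly_Mapping.lookup p t) * subst_monomial a t)"
  unfolding mpol_subst_def
  by (rule sum.mono_neutral_left) (use assms in \<open>auto simp: in_keys_iff mpol_const_simps\<close>)

lemma mpol_subst_add: "mpol_subst a (p + q) = mpol_subst a p + mpol_subst a q"
proof -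
  let ?A = "Poly_Mapping.keys p \<union> Poly_Mapping.keys q"
  have "mpol_subst a r = (\<Sum>t\<in>?A. mpol_const (Poly_Mapping.lookup r t) * subst_monomial a t)"
    if "r \<in> {p, q, p + q}" for r
    by (rule mpol_subst_superset) (use that Poly_Mapping.keys_add[of p q] in auto)
  then show ?thesis
    by (simp add: lookup_add mpol_const_simps distrib_right sum.distrib)
qed

lemma mpol_subst_zero [simp]: "mpol_subst a 0 = 0"
  by (simp add: mpol_subst_def)

lemma mpol_subst_sum: "mpol_subst a (\<Sum>i\<in>I. g i) = (\<Sum>i\<in>I. mpol_subst a (g i))"
  by (induction I rule: infinite_finite_induct) (simp_all add: mpol_subst_add)

lemma mpol_subst_diff: "mpol_subst a (p - q) = mpol_subst a p - mpol_subst a q"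
  by (metis add_diff_cancel diff_add_cancel mpol_subst_add)

lemma mpol_subst_single: "mpol_subst a (Poly_Mapping.single t c) = mpol_const c * subst_monomial a t"
  by (cases "c = 0") (simp_all add: mpol_subst_def mpol_const_simps)

lemma mpol_subst_const: "mpol_subst a (mpol_const c) = mpol_const c"
  using mpol_subst_single[of a 0 c] by (simp add: subst_monomial_def mpol_const_def)

lemma mpol_subst_one [simp]: "mpol_subst a 1 = 1"
  using mpol_subst_const[of a 1] by (simp add: mpol_const_simps)

lemma mpol_subst_var [simp]: "mpol_subst a (mpol_var v) = a v"
  by (simp add: mpol_var_def mpol_subst_single subst_monomial_def mpol_const_simps)

lemma mpol_subst_mult: "mpol_subst a (p * q) = mpol_subst a p * mpol_subst a q"
proof -
  have "p * q = push (\<lambda>t. t) p * push (\<lambda>t. t) q" by (simp add: push_ident)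
  also have "mpol_subst a \<dots> = mpol_subst a p * mpol_subst a q"
    unfolding push_def sum_product mpol_subst_sum mult_single mpol_subst_single
    by (simp add: mpol_subst_def sum_product subst_monomial_add mpol_const_simps ac_simps)
  finally show ?thesis .
qed

lemma mpol_subst_power: "mpol_subst a (p ^ k) = mpol_subst a p ^ k"
  by (induction k) (simp_all add: mpol_subst_mult)

lemma mpol_subst_prod: "mpol_subst a (\<Prod>i\<in>I. g i) = (\<Prod>i\<in>I. mpol_subst a (g i))"
  by (induction I rule: infinite_finite_induct) (simp_all add: mpol_subst_mult)

lemma mpol_subst_subst: "mpol_subst b (mpol_subst a p) = mpol_subst (\<lambda>v. mpol_subst b (a v)) p"
  by (simp add: mpol_subst_def[of a] mpol_subst_def[of "\<lambda>v. mpol_subst b (a v)"] mpol_subst_sum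
      mpol_subst_mult mpol_subst_const subst_monomial_def mpol_subst_prod mpol_subst_power)

definition truncated_vars :: "nat \<Rightarrow> nat \<Rightarrow> (nat, 'k::field) mpol" where
  "truncated_vars k i = (if i < k then mpol_var i else 0)"

text \<open>With \<open>a\<close> a parametrization, these are the equations of the closure of the
  image of the parameter space on which all parameters numbered \<open>k\<close> or more are zero.
  Kernels are prime because the polynomials in the parameters form a domain.\<close>

definition truncation_kernel :: "'v set \<Rightarrow> ('v \<Rightarrow> (nat, 'k::field) mpol) \<Rightarrow> nat \<Rightarrow> ('v, 'k) mpol set" where
  "truncation_kernel V a k = {p \<in> carrier (mpol_ring V). mpol_subst (truncated_vars k) (mpol_subst a p) = 0}"

lemma primeideal_truncation_kernel: "primeideal (truncation_kernel V a k) (mpol_ring V)"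
  unfolding truncation_kernel_def
  by (rule primeideal_kernel) (simp_all add: mpol_subst_add mpol_subst_mult)

text \<open>Truncating at \<open>l\<close> and then at the smaller \<open>k\<close> is the same as
  truncating at \<open>k\<close>.\<close>

lemma truncation_kernel_antimono:
  assumes "k \<le> l"
  shows "truncation_kernel V a l \<subseteq> truncation_kernel V a k"
proof -
  have "mpol_subst (truncated_vars k) q = mpol_subst (truncated_vars k) (mpol_subst (truncated_vars l) q)"
    for q :: "(nat, 'k::field) mpol"
    unfolding mpol_subst_subst
    by (rule arg_cong[of _ _ "\<lambda>a. mpol_subst a q"]) (use assms in \<open>auto simp: truncated_vars_def fun_eq_iff\<close>)
  then show ?thesis
    unfolding truncation_kernel_def by (metis (mono_tags, lifting) Collect_mono mpol_subst_zero)
qed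

lemma truncation_kernel_strict:
  assumes "v \<in> V" "mpol_subst (truncated_vars (Suc k)) (a v) \<noteq> 0" "mpol_subst (truncated_vars k) (a v) = 0"
  shows "truncation_kernel V a (Suc k) \<subset> truncation_kernel V a k"
proof -
  have "mpol_var v \<in> truncation_kernel V a k - truncation_kernel V a (Suc k)"
    using assms by (simp add: truncation_kernel_def mpol_var_in_carrier)
  then show ?thesis using truncation_kernel_antimono[of k "Suc k"] by auto
qed

section \<open>Hilbert functions of monomial quotients\<close>

lemma mpol_quot_eq_iff:
  fixes J :: "('v, 'k::field) mpol set"
  assumes "ideal J (mpol_ring V)" "p \<in> carrier (mpol_ring V)" "q \<in> carrier (mpol_ring V)"
  shows "a_r_coset (mpol_ring V) J p = a_r_coset (mpol_ring V) J q \<longleftrightarrow> p - q \<in> J"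
proof -
  let ?R = "mpol_ring V :: ('v, 'k) mpol ring"
  interpret cring ?R by (rule mpol_ring_cring)
  interpret J: ideal J ?R by fact
  have "p \<ominus>\<^bsub>?R\<^esub> q = p - q"
  proof -
    have "\<ominus>\<^bsub>?R\<^esub> q = - q"
      by (rule minus_equality) (use assms in \<open>auto simp: carrier_mpol_ring_closed\<close>)
    then show ?thesis by (simp add: a_minus_def)
  qed
  then show ?thesis
    using quotient_eq_iff_same_a_r_cos[OF assms(1-3)] by simp
qed

lemma subfield_range_mpol_const: "subfield (range mpol_const) (mpol_ring V :: ('v, 'k::field) mpol ring)"
proof -
  let ?R = "mpol_ring V :: ('v, 'k) mpol ring"
  interpret R: cring ?R by (rule mpol_ring_cring)
  have "subring (range mpol_const) ?R"
  proof (rule R.subringI)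
    fix h assume "h \<in> range (mpol_const :: 'k \<Rightarrow> ('v, 'k) mpol)"
    then obtain c where h: "h = mpol_const c" by blast
    have "\<ominus>\<^bsub>?R\<^esub> h = mpol_const (- c)"
      by (rule R.minus_equality) (simp_all add: h mpol_const_simps flip: mpol_const_simps(3))
    then show "\<ominus>\<^bsub>?R\<^esub> h \<in> range mpol_const" by simp
  next
    show "\<one>\<^bsub>?R\<^esub> \<in> range mpol_const"
      using mpol_const_simps(2) by (metis mpol_ring_simps(2) rangeI)
  next
    fix a b assume "a \<in> range (mpol_const :: 'k \<Rightarrow> ('v, 'k) mpol)" "b \<in> range (mpol_const :: 'k \<Rightarrow> ('v, 'k) mpol)"
    then show "a \<otimes>\<^bsub>?R\<^esub> b \<in> range mpol_const" "a \<oplus>\<^bsub>?R\<^esub> b \<in> range mpol_const"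
      by (auto simp flip: mpol_const_simps)
  qed auto
  moreover have "Units (?R\<lparr>carrier := range mpol_const\<rparr>) = range mpol_const - {\<zero>\<^bsub>?R\<^esub>}"
  proof (intro equalityI subsetI)
    fix x
    assume "x \<in> Units (?R\<lparr>carrier := range mpol_const\<rparr>)"
    then show "x \<in> range mpol_const - {\<zero>\<^bsub>?R\<^esub>}"
      by (auto simp: Units_def)
  next
    fix x assume "x \<in> range mpol_const - {\<zero>\<^bsub>?R\<^esub>}"
    then obtain c where x: "x = mpol_const c" "x \<noteq> 0" by auto
    then have "c \<noteq> 0" using mpol_const_simps(1) by metis
    with x have "x * mpol_const (inverse c) = 1"
      by (simp flip: mpol_const_simps(4)) (simp add: mpol_const_simps)
    then show "x \<in> Units (?R\<lparr>carrier := range mpol_const\<rparr>)"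
      using x(1) by (auto simp: Units_def mult.commute)
  qed
  ultimately show ?thesis
    by (intro R.subfieldI R.subcringI) (auto simp: mult.commute)
qed

text \<open>If \<open>J\<close> identifies monomials exactly along the fibres of \<open>\<phi>\<close>, the fibres form a basis of the
  quotient.\<close>

lemma hilbert_function_eq_card:
  fixes V :: "'v set" and J :: "('v, 'k::field) mpol set" and \<phi> :: "('v \<Rightarrow>\<^sub>0 nat) \<Rightarrow> 'b"
  defines "R \<equiv> mpol_ring V"
  assumes J: "ideal J R"
    and ker: "\<And>p. p \<in> carrier R \<Longrightarrow> p \<in> J \<longleftrightarrow> push \<phi> p = 0"
    and fin: "finite {t. Poly_Mapping.keys t \<subseteq> V \<and> mono_degree t = d}"
  shows "hilbert_function (R Quot J) (a_r_coset R J ` range mpol_const)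
      (\<lambda>d. a_r_coset R J ` homogeneous_part V d) d
    = card (\<phi> ` {t. Poly_Mapping.keys t \<subseteq> V \<and> mono_degree t = d})"
proof -
  interpret R: cring R unfolding R_def by (rule mpol_ring_cring)
  interpret J: ideal J R by fact
  let ?A = "R Quot J" and ?q = "a_r_coset R J" and ?M = "{t. Poly_Mapping.keys t \<subseteq> V \<and> mono_degree t = d}"
  let ?K = "?q ` range mpol_const"
  interpret A: cring ?A by (rule J.quotient_is_cring[OF R.is_cring])
  interpret q: ring_hom_ring R ?A ?q by (rule J.rcos_ring_hom_ring)
  have q_eq: "?q p = ?q r \<longleftrightarrow> p - r \<in> J" if "p \<in> carrier R" "r \<in> carrier R" for p r
    using mpol_quot_eq_iff J that unfolding R_def by blast
  \<comment> \<open>The image of the constants is a field only if the quotient is nontrivial;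
    \<open>push\<close> separates 1 from 0.\<close>
  have one: "\<one>\<^bsub>?A\<^esub> \<noteq> \<zero>\<^bsub>?A\<^esub>"
  proof -
    have "push \<phi> 1 = Poly_Mapping.single (\<phi> 0) (1 :: 'k)" using push_single[of \<phi> 0 "1 :: 'k"] by simp
    then have "push \<phi> 1 \<noteq> (0 :: 'b \<Rightarrow>\<^sub>0 'k)"
      by (metis lookup_single_eq lookup_zero zero_neq_one)
    then have "1 \<notin> J" using ker[of 1] by (simp add: R_def)
    then have "?q 1 \<noteq> ?q 0" using q_eq[of 1 0] by (simp add: R_def)
    then show ?thesis using q.hom_one q.hom_zero by (simp add: R_def)
  qed
  have K: "subfield ?K ?A"
  proof (rule q.img_is_subfield(2)[OF _ one])
    show "subfield (range mpol_const) R"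
      unfolding R_def by (rule subfield_range_mpol_const)
  qed
  \<comment> \<open>One representative monomial for each class of degree \<open>d\<close>.\<close>
  define s where "s x = (SOME t. t \<in> ?M \<and> \<phi> t = x)" for x
  have s: "s x \<in> ?M" "\<phi> (s x) = x" if "x \<in> \<phi> ` ?M" for x
    using someI_ex[of "\<lambda>t. t \<in> ?M \<and> \<phi> t = x"] that by (auto simp: s_def)
  obtain xs where xs: "set xs = \<phi> ` ?M" "distinct xs"
    using finite_distinct_list[of "\<phi> ` ?M"] fin by blast
  define us where "us = map s xs"
  have us: "set us \<subseteq> ?M" "distinct (map \<phi> us)" "length us = card (\<phi> ` ?M)"
  proof -
    show "set us \<subseteq> ?M" using s xs by (auto simp: us_def)
    have "map \<phi> us = xs" unfolding us_def map_map by (rule map_idI) (use s xs in auto)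
    then show "distinct (map \<phi> us)" using xs by simp
    show "length us = card (\<phi> ` ?M)" using xs distinct_card by (metis us_def length_map)
  qed
  let ?b = "\<lambda>u. ?q (Poly_Mapping.single u 1)"
  have carr: "p \<in> carrier R" if "Poly_Mapping.keys p \<subseteq> set vs" "set vs \<subseteq> ?M" for p vs
    using that by (fastforce simp: R_def mem_carrier_mpol_ring)
  \<comment> \<open>\<open>Span\<close> is built by adding one vector at a time, so this goes by
    induction on the list: the coefficient of \<open>v\<close> is split off.\<close>
  have Span: "A.Span ?K (map ?b vs) = ?q ` {p. Poly_Mapping.keys p \<subseteq> set vs}" if "set vs \<subseteq> ?M" for vs
    using that
  proof (induction vs)
    case Nil
    have "?q 0 = \<zero>\<^bsub>?A\<^esub>" using q.hom_zero by (simp add: R_def)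
    then show ?case by simp
  next
    case (Cons v vs)
    have v: "Poly_Mapping.single v 1 \<in> carrier R"
      using Cons.prems by (intro carr[of _ "[v]"]) auto
    have comb: "?q (mpol_const c) \<otimes>\<^bsub>?A\<^esub> ?b v \<oplus>\<^bsub>?A\<^esub> ?q p = ?q (Poly_Mapping.single v c + p)"
      if "Poly_Mapping.keys p \<subseteq> set vs" for c p
    proof -
      have p: "p \<in> carrier R" using Cons.prems that by (intro carr[of _ vs]) auto
      have c: "mpol_const c \<in> carrier R" by (simp add: R_def)
      have "mpol_const c * Poly_Mapping.single v 1 \<in> carrier R"
        using R.m_closed[OF c v] by (simp add: R_def)
      then have "?q (mpol_const c * Poly_Mapping.single v 1 + p)
          = ?q (mpol_const c) \<otimes>\<^bsub>?A\<^esub> ?b v \<oplus>\<^bsub>?A\<^esub> ?q p"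
        using q.hom_mult[OF c v] q.hom_add[OF _ p] by (simp add: R_def)
      then show ?thesis by (simp add: mpol_const_def mult_single)
    qed
    have "?q ` {p. Poly_Mapping.keys p \<subseteq> set (v # vs)}
        = {u. \<exists>c. \<exists>p. Poly_Mapping.keys p \<subseteq> set vs \<and> u = ?q (Poly_Mapping.single v c + p)}" (is "?q ` ?L = ?S")
    proof (intro equalityI subsetI)
      fix u assume "u \<in> ?q ` ?L"
      then obtain p where p: "p \<in> ?L" "u = ?q p" by blast
      let ?c = "Poly_Mapping.lookup p v"
      have "Poly_Mapping.keys (p - Poly_Mapping.single v ?c) \<subseteq> set vs"
        using p(1) by (auto simp: in_keys_iff lookup_minus lookup_single when_def split: if_splits)
      then show "u \<in> ?S"
        using p(2) by (intro CollectI exI[of _ ?c] exI[of _ "p - Poly_Mapping.single v ?c"]) simp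
    next
      fix u assume "u \<in> ?S"
      then obtain c p where p: "Poly_Mapping.keys p \<subseteq> set vs" "u = ?q (Poly_Mapping.single v c + p)" by blast
      then have "Poly_Mapping.keys (Poly_Mapping.single v c + p) \<subseteq> set (v # vs)"
        using Poly_Mapping.keys_add[of "Poly_Mapping.single v c" p] by (auto split: if_splits)
      then show "u \<in> ?q ` ?L" using p(2) by blast
    qed
    also have "\<dots> = A.line_extension ?K (?b v) (?q ` {p. Poly_Mapping.keys p \<subseteq> set vs})"
    proof (rule Set.set_eqI)
      fix u
      have "u \<in> A.line_extension ?K (?b v) (?q ` {p. Poly_Mapping.keys p \<subseteq> set vs})
          \<longleftrightarrow> (\<exists>c p. Poly_Mapping.keys p \<subseteq> set vs \<and> u = ?q (mpol_const c) \<otimes>\<^bsub>?A\<^esub> ?b v \<oplus>\<^bsub>?A\<^esub> ?q p)"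
        unfolding A.line_extension_mem_iff by blast
      also have "\<dots> \<longleftrightarrow> (\<exists>c p. Poly_Mapping.keys p \<subseteq> set vs \<and> u = ?q (Poly_Mapping.single v c + p))"
        using comb by metis
      finally show "u \<in> ?S \<longleftrightarrow> u \<in> A.line_extension ?K (?b v) (?q ` {p. Poly_Mapping.keys p \<subseteq> set vs})"
        by blast
    qed
    also have "\<dots> = A.Span ?K (map ?b (v # vs))"
      using Cons by simp
    finally show ?case by simp
  qed
  have indep: "A.independent ?K (map ?b vs)" if "set vs \<subseteq> ?M" "distinct (map \<phi> vs)" for vs
    using that
  proof (induction vs)
    case Nil
    then show ?case by simp
  next
    case (Cons v vs)
    have v: "Poly_Mapping.single v 1 \<in> carrier R"
      using Cons.prems by (intro carr[of _ "[v]"]) auto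
    \<comment> \<open>In a relation \<open>push\<close> would leave the class of \<open>v\<close> in
      the support, although \<open>v\<close> and the members of \<open>vs\<close> have distinct
      classes.\<close>
    have "?b v \<notin> A.Span ?K (map ?b vs)"
    proof
      assume "?b v \<in> A.Span ?K (map ?b vs)"
      then obtain p where p: "Poly_Mapping.keys p \<subseteq> set vs" "?b v = ?q p"
        using Span[of vs] Cons.prems by auto
      have pc: "p \<in> carrier R" using p(1) Cons.prems by (intro carr[of _ vs]) auto
      have "Poly_Mapping.single v 1 - p \<in> J" using q_eq[OF v pc] p(2) by simp
      moreover have "Poly_Mapping.single v 1 - p \<in> carrier R"
        using v pc unfolding R_def by (rule carrier_mpol_ring_closed)
      ultimately have "push \<phi> p = Poly_Mapping.single (\<phi> v) 1"
        using ker by (simp add: push_diff)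
      then have "\<phi> v \<in> Poly_Mapping.keys (push \<phi> p)" by simp
      then have "\<phi> v \<in> \<phi> ` set vs" using keys_push_subset[of \<phi> p] p(1) by blast
      then show False using Cons.prems by auto
    qed
    then show ?case
      using Cons q.hom_closed[OF v] by (auto intro: A.li_Cons)
  qed
  have "A.Span ?K (map ?b us) = ?q ` homogeneous_part V d"
  proof -
    have "?q ` {p. Poly_Mapping.keys p \<subseteq> set us} = ?q ` homogeneous_part V d"
    proof (intro equalityI subsetI)
      fix u assume "u \<in> ?q ` {p. Poly_Mapping.keys p \<subseteq> set us}"
      then show "u \<in> ?q ` homogeneous_part V d"
        using us(1) by (fastforce simp: homogeneous_part_def mem_carrier_mpol_ring)
    next
      fix u assume "u \<in> ?q ` homogeneous_part V d"
      then obtain p where p: "p \<in> homogeneous_part V d" "u = ?q p" by blast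
      \<comment> \<open>Each monomial is replaced by the representative of its class, which changes
        \<open>p\<close> only by an element of \<open>J\<close>.\<close>
      let ?p = "push (s \<circ> \<phi>) p"
      have keys: "Poly_Mapping.keys p \<subseteq> ?M"
        using p(1) by (auto simp: homogeneous_part_def mem_carrier_mpol_ring)
      have "Poly_Mapping.keys ?p \<subseteq> set us"
        using keys_push_subset[of "s \<circ> \<phi>" p] keys xs(1) by (fastforce simp: us_def)
      moreover from this have pc: "?p \<in> carrier R" using us(1) by (rule carr)
      moreover have "push \<phi> ?p = push \<phi> p"
        unfolding push_push using keys s(2) by (intro push_cong) auto
      then have "push \<phi> (p - ?p) = 0" by (simp add: push_diff)
      moreover have "p \<in> carrier R" using p(1) by (simp add: homogeneous_part_def R_def)
      ultimately have "?q p = ?q ?p"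
        using q_eq ker carrier_mpol_ring_closed(4) unfolding R_def by blast
      then show "u \<in> ?q ` {p. Poly_Mapping.keys p \<subseteq> set us}"
        using p(2) \<open>Poly_Mapping.keys ?p \<subseteq> set us\<close> by blast
    qed
    then show ?thesis using Span[OF us(1)] by (rule trans[rotated])
  qed
  from A.dimensionI[OF K indep[OF us(1,2)] this]
  have "A.dimension (card (\<phi> ` ?M)) ?K (?q ` homogeneous_part V d)" using us(3) by simp
  then show ?thesis
    unfolding hilbert_function_def
    using A.dimension_is_inj[OF K] by (intro the_equality) auto
qed

section \<open>Hilbert series of Segre products\<close>

text \<open>The Hilbert series of the ring of rank one matrices with \<open>p + 1\<close> rows and
  \<open>q + 1\<close> columns, that is, of the Segre embedding. For \<open>q = 0\<close> it is the
  series of a polynomial ring in \<open>p + 1\<close> variables.\<close>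

definition segre_series :: "nat \<Rightarrow> nat \<Rightarrow> int fps" where
  "segre_series p q = Abs_fps (\<lambda>d. int (((p + d) choose d) * ((q + d) choose d)))"

definition segre_numerator :: "nat \<Rightarrow> nat \<Rightarrow> int poly" where
  "segre_numerator p q = (\<Sum>k\<le>p. monom (int ((p choose k) * (q choose k))) k)"

lemma coeff_segre_numerator: "poly.coeff (segre_numerator p q) k = int ((p choose k) * (q choose k))"
  by (simp add: segre_numerator_def coeff_sum)

lemma poly_segre_numerator_1: "poly (segre_numerator p q) 1 = int (\<Sum>k\<le>p. (p choose k) * (q choose k))"
  by (simp add: segre_numerator_def poly_sum poly_monom)

lemma fps_nth_one_minus_X_mult:
  "fps_nth ((1 - fps_X) * f) 0 = fps_nth f 0"
  "fps_nth ((1 - fps_X) * f) (Suc n) = fps_nth f (Suc n) - fps_nth (f :: int fps) n"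
  by (simp_all add: left_diff_distrib)

text \<open>Multiplication by \<open>1 - t\<close> takes differences of neighbouring coefficients,
  which by Pascal's rule lowers \<open>q\<close> by one.\<close>

lemma segre_series_0: "segre_series 0 q * (1 - fps_X) ^ Suc q = 1"
proof (induction q)
  case 0
  have "(1 - fps_X) * segre_series 0 0 = 1"
  proof (rule fps_ext)
    fix n show "fps_nth ((1 - fps_X) * segre_series 0 0) n = fps_nth 1 n"
      by (cases n) (simp_all add: fps_nth_one_minus_X_mult segre_series_def)
  qed
  then show ?case by (simp add: mult.commute)
next
  case (Suc q)
  have step: "(1 - fps_X) * segre_series 0 (Suc q) = segre_series 0 q"
  proof (rule fps_ext)
    fix n show "fps_nth ((1 - fps_X) * segre_series 0 (Suc q)) n = fps_nth (segre_series 0 q) n"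
      by (cases n) (simp_all add: fps_nth_one_minus_X_mult segre_series_def)
  qed
  have "segre_series 0 (Suc q) * (1 - fps_X) ^ Suc (Suc q)
      = ((1 - fps_X) * segre_series 0 (Suc q)) * (1 - fps_X) ^ Suc q"
    by (simp only: power_Suc ac_simps)
  also have "\<dots> = 1"
    using Suc.IH by (simp only: step)
  finally show ?case .
qed

text \<open>Raising \<open>p\<close> multiplies the coefficient in degree \<open>n\<close> by
  \<open>(p + 1 + n) / (p + 1)\<close>, and the factor \<open>n\<close> is produced by the operator
  \<open>t d/dt\<close>.\<close>

lemma segre_series_step:
  "of_nat (Suc p) * segre_series (Suc p) q = of_nat (Suc p) * segre_series p q + fps_X * fps_deriv (segre_series p q)"
proof (rule fps_ext)
  fix n
  have "Suc p * ((Suc p + n) choose n) = (Suc p + n) * ((p + n) choose n)"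
    using Suc_times_binomial_eq[of "p + n" p] binomial_symmetric[of n "p + n"] binomial_symmetric[of n "Suc p + n"]
    by (simp add: ac_simps)
  then have "int (Suc p) * int ((Suc p + n) choose n) = int (Suc p + n) * int ((p + n) choose n)"
    by (metis of_nat_mult)
  then have "int (Suc p) * (int ((Suc p + n) choose n) * int ((q + n) choose n))
      = int (Suc p) * (int ((p + n) choose n) * int ((q + n) choose n))
        + int n * (int ((p + n) choose n) * int ((q + n) choose n))"
    by (simp only: mult.assoc[symmetric] distrib_right[symmetric] of_nat_add)
  moreover have "fps_nth (fps_X * fps_deriv f) n = int n * fps_nth f n" for f :: "int fps"
    by (cases n) simp_all
  ultimately show "fps_nth (of_nat (Suc p) * segre_series (Suc p) q) n
      = fps_nth (of_nat (Suc p) * segre_series p q + fps_X * fps_deriv (segre_series p q)) n"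
    by (simp only: segre_series_def fps_mult_of_nat_nth fps_add_nth fps_nth_Abs_fps of_nat_mult)
qed

lemma int_choose_Suc: "(int k + 1) * int (p choose Suc k) = (int p - int k) * int (p choose k)"
proof (cases "k \<le> p")
  case True
  have "Suc k * (p choose Suc k) = (p - k) * (p choose k)"
    by (metis binomial_absorption binomial_absorb_comp)
  then have "int (Suc k) * int (p choose Suc k) = int (p - k) * int (p choose k)"
    by (metis of_nat_mult)
  then show ?thesis using True by (simp add: of_nat_diff add.commute)
next
  case False
  then show ?thesis by (simp add: binomial_eq_0)
qed

text \<open>Induction on \<open>p\<close>: differentiating the identity for \<open>p\<close> turns
  the differential relation of \<open>segre_series_step\<close> into a recurrence for the
  numerators, which is then compared coefficientwise.\<close>

lemma segre_series_rational:
  "segre_series p q * (1 - fps_X) ^ (p + q + 1) = fps_of_poly (segre_numerator p q)"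
proof (induction p)
  case 0
  have "segre_numerator 0 q = 1" by (simp add: segre_numerator_def)
  then show ?case using segre_series_0[of q] by simp
next
  case (Suc p)
  define S h s and Y :: "int fps" where "S = segre_series p q" and "h = fps_of_poly (segre_numerator p q)"
    and "s = p + q" and "Y = 1 - fps_X"
  have IH: "S * Y ^ Suc s = h" using Suc by (simp add: S_def h_def s_def Y_def)
  have "fps_deriv Y = - 1" by (simp add: Y_def)
  then have "fps_deriv (Y ^ Suc s) = - (of_nat (Suc s) * Y ^ s)"
    using fps_deriv_power'[of Y "Suc s"] by (simp add: algebra_simps del: power_Suc)
  then have "fps_deriv (S * Y ^ Suc s) = fps_deriv S * Y ^ Suc s - of_nat (Suc s) * S * Y ^ s"
    by (simp add: fps_deriv_mult del: power_Suc)
  then have "fps_deriv h * Y = (fps_deriv S * Y ^ Suc s - of_nat (Suc s) * S * Y ^ s) * Y"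
    by (simp only: IH)
  also have "\<dots> = fps_deriv S * Y ^ Suc (Suc s) - of_nat (Suc s) * (S * Y ^ Suc s)"
    by (simp add: algebra_simps)
  finally have "fps_deriv h * Y = fps_deriv S * Y ^ Suc (Suc s) - of_nat (Suc s) * h"
    by (simp only: IH)
  \<comment> \<open>This removes the derivative of the series in favour of that of the
    numerator.\<close>
  then have dS: "fps_deriv S * Y ^ Suc (Suc s) = Y * fps_deriv h + of_nat (Suc s) * h"
    by (simp add: mult.commute)
  have "of_nat (Suc p) * (segre_series (Suc p) q * Y ^ Suc (Suc s))
      = (of_nat (Suc p) * S + fps_X * fps_deriv S) * Y ^ Suc (Suc s)"
    using segre_series_step[of p q] by (metis S_def mult.assoc)
  also have "\<dots> = Y * (of_nat (Suc p) * (S * Y ^ Suc s)) + fps_X * (fps_deriv S * Y ^ Suc (Suc s))"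
    by (simp add: algebra_simps)
  also have "\<dots> = Y * (of_nat (Suc p) * h + fps_X * fps_deriv h) + of_nat (Suc s) * (fps_X * h)"
    unfolding dS IH by (simp only: distrib_left ac_simps)
  also have "\<dots> = of_nat (Suc p) * fps_of_poly (segre_numerator (Suc p) q)"
  proof (rule fps_ext)
    fix n
    have Xd: "fps_nth (fps_X * fps_deriv f) n = int n * fps_nth f n" for f :: "int fps" and n
      by (cases n) simp_all
    have XS: "fps_nth (fps_X * h) (Suc n) = fps_nth h n" for n
      by simp
    show "fps_nth (Y * (of_nat (Suc p) * h + fps_X * fps_deriv h) + of_nat (Suc s) * (fps_X * h)) n
        = fps_nth (of_nat (Suc p) * fps_of_poly (segre_numerator (Suc p) q)) n"
    proof (cases n)
      case 0
      then show ?thesis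
        by (simp add: Y_def fps_nth_one_minus_X_mult fps_mult_of_nat_nth Xd h_def fps_of_poly_nth coeff_segre_numerator
            del: of_nat_Suc)
    next
      case (Suc k)
      define a a' b b' where "a = int (p choose k)" and "a' = int (p choose Suc k)"
        and "b = int (q choose k)" and "b' = int (q choose Suc k)"
      \<comment> \<open>The coefficient identity is quadratic in binomials; these two products
        reduce it to linear arithmetic.\<close>
      have "(int k + 1) * a' * b' = (int p - int k) * a * b'" "a * ((int k + 1) * b') = a * ((int q - int k) * b)"
        by (simp_all only: a_def a'_def b_def b'_def int_choose_Suc)
      then have "(int p + 1) * (a + a') * b' = (int p + 1) * (a' * b' - a * b)
          + (int k + 1) * a' * b' - int k * (a * b) + (int p + int q + 1) * (a * b)"
        by (simp add: algebra_simps)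
      then show ?thesis
        unfolding Suc Y_def fps_add_nth fps_nth_one_minus_X_mult fps_mult_of_nat_nth Xd XS h_def
          fps_of_poly_nth coeff_segre_numerator s_def of_nat_mult binomial_Suc_Suc of_nat_add of_nat_Suc a_def a'_def b_def b'_def
        by (simp add: algebra_simps coeff_segre_numerator)
    qed
  qed
  finally have "segre_series (Suc p) q * Y ^ Suc (Suc s) = fps_of_poly (segre_numerator (Suc p) q)"
    by (metis mult_left_cancel of_nat_eq_0_iff nat.distinct(1))
  then show ?case by (simp add: Y_def s_def)
qed

section \<open>Monomials with prescribed margins\<close>

definition monomials :: "'v set \<Rightarrow> nat \<Rightarrow> ('v \<Rightarrow>\<^sub>0 nat) set" where
  "monomials V d = {t. Poly_Mapping.keys t \<subseteq> V \<and> mono_degree t = d}"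

text \<open>Indexed by the degree \<open>k\<close> left to the old variables, so that the count
  becomes a sum of the form in \<open>sum_choose_lower\<close>.\<close>

lemma monomials_insert:
  assumes "v \<notin> V"
  shows "monomials (insert v V) d = (\<Union>k\<le>d. (+) (Poly_Mapping.single v (d - k)) ` monomials V k)"
proof (intro equalityI subsetI)
  fix t assume t: "t \<in> monomials (insert v V) d"
  let ?j = "Poly_Mapping.lookup t v"
  define u where "u = t - Poly_Mapping.single v ?j"
  have split: "t = Poly_Mapping.single v ?j + u"
    by (rule poly_mapping_eqI) (auto simp: u_def lookup_add lookup_minus lookup_single when_def)
  have deg: "d = ?j + mono_degree u"
    using t arg_cong[OF split, of mono_degree] by (simp add: monomials_def mono_degree_add)
  have "v \<notin> Poly_Mapping.keys u"
    by (simp add: u_def in_keys_iff lookup_minus)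
  then have "u \<in> monomials V (mono_degree u)"
    using t arg_cong[OF split, of Poly_Mapping.keys] by (auto simp: monomials_def keys_add_nat)
  moreover have "d - mono_degree u = ?j" "mono_degree u \<le> d" using deg by simp_all
  ultimately show "t \<in> (\<Union>k\<le>d. (+) (Poly_Mapping.single v (d - k)) ` monomials V k)"
    using split by (intro UN_I[of "mono_degree u"] image_eqI[of _ _ u]) simp_all
next
  fix t assume "t \<in> (\<Union>k\<le>d. (+) (Poly_Mapping.single v (d - k)) ` monomials V k)"
  then show "t \<in> monomials (insert v V) d"
    by (auto simp: monomials_def mono_degree_add keys_add_nat split: if_splits)
qed

lemma finite_monomials: "finite V \<Longrightarrow> finite (monomials V d)"
proof (induction V arbitrary: d rule: finite_induct)
  case empty
  have "monomials {} d \<subseteq> {0}" by (auto simp: monomials_def)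
  then show ?case by (rule finite_subset) simp
next
  case (insert v V)
  then show ?case by (simp add: monomials_insert)
qed

lemma card_monomials:
  assumes "finite V" "V \<noteq> {}"
  shows "card (monomials V d) = (card V - 1 + d) choose d"
  using assms
proof (induction V arbitrary: d rule: finite_ne_induct)
  case (singleton v)
  have "monomials {v} d = {Poly_Mapping.single v d}"
  proof (intro equalityI subsetI)
    fix t assume t: "t \<in> monomials {v} d"
    then have "mono_degree t = Poly_Mapping.lookup t v"
      using mono_degree_superset[of "{v}" t] by (simp add: monomials_def)
    then have "t = Poly_Mapping.single v d"
      using t by (intro poly_mapping_eqI) (auto simp: monomials_def lookup_single when_def in_keys_iff)
    then show "t \<in> {Poly_Mapping.single v d}" by simp
  qed (auto simp: monomials_def split: if_splits)
  then show ?case by simp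
next
  case (insert v V)
  have inj: "inj_on ((+) (Poly_Mapping.single v (d - k))) (monomials V k)" for k
    by (simp add: inj_on_def)
  have disj: "(+) (Poly_Mapping.single v (d - k)) ` monomials V k \<inter> (+) (Poly_Mapping.single v (d - l)) ` monomials V l = {}"
    if "k \<le> d" "l \<le> d" "k \<noteq> l" for k l
  proof (rule equals0I)
    have look: "Poly_Mapping.lookup (Poly_Mapping.single v (d - k) + t) v = d - k" if "t \<in> monomials V k" for k t
      using that \<open>v \<notin> V\<close> by (auto simp: monomials_def lookup_add in_keys_iff)
    fix x
    assume "x \<in> (+) (Poly_Mapping.single v (d - k)) ` monomials V k \<inter> (+) (Poly_Mapping.single v (d - l)) ` monomials V l"
    then obtain t u where "t \<in> monomials V k" "x = Poly_Mapping.single v (d - k) + t"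
      "u \<in> monomials V l" "x = Poly_Mapping.single v (d - l) + u" by blast
    then have "d - k = d - l" using look by metis
    then show False using that by simp
  qed
  have "card (monomials (insert v V) d) = (\<Sum>k\<le>d. card (monomials V k))"
    unfolding monomials_insert[OF \<open>v \<notin> V\<close>]
    using disj finite_monomials[OF \<open>finite V\<close>] by (subst card_UN_disjoint) (simp_all add: card_image[OF inj])
  also have "\<dots> = (\<Sum>k\<le>d. (card V - 1 + k) choose k)"
    using insert.IH by simp
  also have "\<dots> = Suc (card V - 1 + d) choose d"
    by (rule sum_choose_lower)
  also have "Suc (card V - 1 + d) = card (insert v V) - 1 + d"
    using insert.hyps card_gt_0_iff[of V] by simp
  finally show ?case .
qed

text \<open>The hockey-stick identity writes the binomial as \<open>d + 1\<close> summands, each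
  bounded by the power for smaller \<open>p\<close>.\<close>

lemma binomial_le_power: "(p + d) choose d \<le> (d + 1) ^ p"
proof (induction p arbitrary: d)
  case 0
  then show ?case by simp
next
  case (Suc p)
  have "(Suc p + d) choose d = (\<Sum>k\<le>d. (p + k) choose k)"
    using sum_choose_lower[of p d] by simp
  also have "\<dots> \<le> (\<Sum>k\<le>d. (d + 1) ^ p)"
    using Suc by (intro sum_mono) (meson add_le_mono1 atMost_iff le_trans power_mono zero_le)
  finally show ?case by simp
qed

text \<open>Greedy filling: put a unit into a row and a column that both still need one, and
  continue with the remaining sums.\<close>

lemma margins_realizable:
  assumes "Poly_Mapping.keys r \<subseteq> R" "Poly_Mapping.keys c \<subseteq> C" "mono_degree r = mono_degree c"
  shows "\<exists>t :: ('a \<times> 'b) \<Rightarrow>\<^sub>0 nat. Poly_Mapping.keys t \<subseteq> R \<times> C \<and> push fst t = r \<and> push snd t = c"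
  using assms
proof (induction "mono_degree r" arbitrary: r c)
  case 0
  then have "r = 0" "c = 0" by (auto simp: mono_degree_eq_0_iff dest: sym)
  then show ?case by (intro exI[of _ 0]) simp
next
  case (Suc d)
  then have "r \<noteq> 0" "c \<noteq> 0" by (auto simp flip: mono_degree_eq_0_iff)
  then obtain i j where i: "Poly_Mapping.lookup r i \<noteq> 0" and j: "Poly_Mapping.lookup c j \<noteq> 0"
    by (metis lookup_zero poly_mapping_eqI)
  obtain r' where r': "r = Poly_Mapping.single i 1 + r'" using single_le_split[OF i] .
  obtain c' where c': "c = Poly_Mapping.single j 1 + c'" using single_le_split[OF j] .
  have "\<exists>t. Poly_Mapping.keys t \<subseteq> R \<times> C \<and> push fst t = r' \<and> push snd t = c'"
    by (rule Suc.hyps(1)) (use Suc r' c' in \<open>auto simp: keys_add_nat mono_degree_add\<close>)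
  then obtain t where t: "Poly_Mapping.keys t \<subseteq> R \<times> C" "push fst t = r'" "push snd t = c'" by blast
  show ?case
    using t r' c' Suc.prems
    by (intro exI[of _ "Poly_Mapping.single (i, j) 1 + t"]) (auto simp: push_add keys_add_nat)
qed

definition meets_both :: "'b set \<Rightarrow> 'b set \<Rightarrow> ('b \<Rightarrow>\<^sub>0 nat) \<Rightarrow> bool" where
  "meets_both C1 C2 c \<longleftrightarrow> Poly_Mapping.keys c \<inter> C1 \<noteq> {} \<and> Poly_Mapping.keys c \<inter> C2 \<noteq> {}"

text \<open>The third component keeps apart the monomials that no swap can move.\<close>

definition margin_class ::
    "'b set \<Rightarrow> 'b set \<Rightarrow> (('a \<times> 'b) \<Rightarrow>\<^sub>0 nat) \<Rightarrow> ('a \<Rightarrow>\<^sub>0 nat) \<times> ('b \<Rightarrow>\<^sub>0 nat) \<times> (('a \<times> 'b) \<Rightarrow>\<^sub>0 nat)" where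
  "margin_class C1 C2 t =
     (push fst t, push snd t, if meets_both C1 C2 (push snd t) then 0 else t)"

lemma margin_class_eqD:
  assumes "margin_class C1 C2 s = margin_class C1 C2 t"
  shows "push fst s = push fst t" "push snd s = push snd t" "\<not> meets_both C1 C2 (push snd s) \<Longrightarrow> s = t"
  using assms by (auto simp: margin_class_def)

text \<open>Margins are additive and a mixed support stays mixed under multiplication. This makes
  the kernel of the class map an ideal.\<close>

lemma margin_class_add_cong:
  assumes "margin_class C1 C2 s = margin_class C1 C2 t"
  shows "margin_class C1 C2 (u + s) = margin_class C1 C2 (u + t)"
proof (cases "meets_both C1 C2 (push snd s)")
  case True
  note eq = margin_class_eqD[OF assms]
  have "meets_both C1 C2 (push snd (u + s))"
    using True by (auto simp: meets_both_def push_add keys_add_nat)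
  then show ?thesis by (simp add: margin_class_def push_add eq)
next
  case False
  then show ?thesis using margin_class_eqD(3)[OF assms] by simp
qed

text \<open>Monomials supported in one part are alone in their classes. A mixed class is a pair of
  margins, and every pair of equal degree whose column vector meets both parts occurs, by
  \<open>margins_realizable\<close>.\<close>

lemma margin_class_monomials:
  assumes "0 < d" and disj: "C1 \<inter> C2 = {}"
  shows "margin_class C1 C2 ` monomials (R \<times> (C1 \<union> C2)) d =
      margin_class C1 C2 ` monomials (R \<times> C1) d \<union> margin_class C1 C2 ` monomials (R \<times> C2) d \<union>
      (\<lambda>(r, c). (r, c, 0)) ` (monomials R d \<times> (monomials (C1 \<union> C2) d - monomials C1 d - monomials C2 d))"
    (is "?L = ?A1 \<union> ?A2 \<union> ?A3")
proof -
  have mixed: "meets_both C1 C2 c \<longleftrightarrow> c \<notin> monomials C1 d \<and> c \<notin> monomials C2 d"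
    if "c \<in> monomials (C1 \<union> C2) d" for c
    using that disj by (auto simp: meets_both_def monomials_def)
  have sub: "push fst t \<in> monomials R d" "push snd t \<in> monomials C d" if "t \<in> monomials (R \<times> C) d" for t C
    using that by (auto simp: monomials_def keys_push_nat mono_degree_push)
  show ?thesis
  proof (intro equalityI subsetI)
    fix x assume "x \<in> ?L"
    then obtain t where t: "t \<in> monomials (R \<times> (C1 \<union> C2)) d" "x = margin_class C1 C2 t" by blast
    show "x \<in> ?A1 \<union> ?A2 \<union> ?A3"
    proof (cases "meets_both C1 C2 (push snd t)")
      case True
      then have "(push fst t, push snd t) \<in>
          monomials R d \<times> (monomials (C1 \<union> C2) d - monomials C1 d - monomials C2 d)"
        using sub[OF t(1)] mixed by auto
      moreover have "x = (push fst t, push snd t, 0)"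
        using True t by (simp add: margin_class_def)
      ultimately have "x \<in> ?A3"
        by (intro image_eqI[of _ _ "(push fst t, push snd t)"]) simp_all
      then show ?thesis by (rule UnI2)
    next
      case False
      have "t \<in> monomials (R \<times> C) d" if "push snd t \<in> monomials C d" for C
      proof -
        have "snd ` Poly_Mapping.keys t \<subseteq> C" "Poly_Mapping.keys t \<subseteq> R \<times> (C1 \<union> C2)" "mono_degree t = d"
          using that t(1) by (simp_all add: monomials_def keys_push_nat)
        then show ?thesis by (auto simp: monomials_def mem_Times_iff)
      qed
      then show ?thesis using False mixed[OF sub(2)[OF t(1)]] t(2) by blast
    qed
  next
    fix x assume "x \<in> ?A1 \<union> ?A2 \<union> ?A3"
    moreover have "?A1 \<subseteq> ?L" "?A2 \<subseteq> ?L"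
      by (intro image_mono; auto simp: monomials_def)+
    moreover have "x \<in> ?L" if x3: "x \<in> ?A3"
    proof -
      obtain r c where rc: "x = (r, c, 0)" "r \<in> monomials R d" "c \<in> monomials (C1 \<union> C2) d"
        "c \<notin> monomials C1 d" "c \<notin> monomials C2 d"
        using x3 by auto
      obtain t where t: "Poly_Mapping.keys t \<subseteq> R \<times> (C1 \<union> C2)" "push fst t = r" "push snd t = c"
        using margins_realizable[of r R c "C1 \<union> C2"] rc by (auto simp: monomials_def)
      have "t \<in> monomials (R \<times> (C1 \<union> C2)) d"
        using t rc(2) by (auto simp: monomials_def mono_degree_push)
      moreover have "x = margin_class C1 C2 t"
        using mixed[OF rc(3)] rc t by (simp add: margin_class_def)
      ultimately show ?thesis by blast
    qed
    ultimately show "x \<in> ?L" by blast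
  qed
qed

lemma monomials_0: "monomials V 0 = {0}"
  by (auto simp: monomials_def mono_degree_eq_0_iff)

lemma monomials_disjoint:
  assumes "0 < d" "V \<inter> W = {}"
  shows "monomials V d \<inter> monomials W d = {}"
proof (rule equals0I)
  fix t assume "t \<in> monomials V d \<inter> monomials W d"
  then have t: "Poly_Mapping.keys t \<subseteq> V" "Poly_Mapping.keys t \<subseteq> W" "mono_degree t = d"
    by (simp_all add: monomials_def)
  then have "Poly_Mapping.keys t = {}" using assms(2) by blast
  then show False using t(3) assms(1) by (simp add: mono_degree_def)
qed

text \<open>The subtracted column vectors are those lying in one part. They stand on the left to
  avoid truncated subtraction.\<close>

lemma card_margin_class_monomials:
  assumes fin: "finite R" "finite C1" "finite C2" and disj: "C1 \<inter> C2 = {}"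
  shows "card (margin_class C1 C2 ` monomials (R \<times> (C1 \<union> C2)) d)
      + card (monomials R d) * (card (monomials C1 d) + card (monomials C2 d))
    = card (monomials (R \<times> C1) d) + card (monomials (R \<times> C2) d)
      + card (monomials R d) * card (monomials (C1 \<union> C2) d)"
proof (cases "d = 0")
  \<comment> \<open>In degree 0 the parts share the monomial 1, yet both sides equal 3.\<close>
  case True
  then show ?thesis by (simp add: monomials_0)
next
  case False
  then have d: "0 < d" by simp
  have fins: "finite (monomials R d)" "finite (monomials C1 d)" "finite (monomials C2 d)"
    "finite (monomials (C1 \<union> C2) d)" "finite (monomials (R \<times> C1) d)" "finite (monomials (R \<times> C2) d)"
    by (simp_all add: finite_monomials fin)
  let ?M = "margin_class C1 C2" and ?f = "\<lambda>(r, c). (r, c, 0 :: ('a \<times> 'b) \<Rightarrow>\<^sub>0 nat)"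
  let ?A1 = "monomials (R \<times> C1) d" and ?A2 = "monomials (R \<times> C2) d"
  let ?A3 = "monomials R d \<times> (monomials (C1 \<union> C2) d - monomials C1 d - monomials C2 d)"
  have pure: "?M t = (push fst t, push snd t, t)" if "t \<in> ?A1 \<union> ?A2" for t
    using that disj by (auto simp: margin_class_def meets_both_def monomials_def keys_push_nat)
  have inj: "inj_on ?M (?A1 \<union> ?A2)"
    by (rule inj_onI) (simp add: pure)
  have "?A1 \<inter> ?A2 = {}"
    by (rule monomials_disjoint[OF d]) (use disj in auto)
  then have c12: "card (?M ` (?A1 \<union> ?A2)) = card ?A1 + card ?A2"
    using fins by (simp add: card_image[OF inj] card_Un_disjoint)
  have "?M ` (?A1 \<union> ?A2) \<inter> ?f ` ?A3 = {}"
  proof (rule equals0I)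
    fix x assume x: "x \<in> ?M ` (?A1 \<union> ?A2) \<inter> ?f ` ?A3"
    then obtain t where t: "t \<in> ?A1 \<union> ?A2" "x = ?M t" by blast
    have "snd (snd x) = 0" using x by auto
    then have "t = 0" using pure[OF t(1)] t(2) by simp
    then show False using t(1) d by (simp add: monomials_def)
  qed
  moreover have "?M ` monomials (R \<times> (C1 \<union> C2)) d = ?M ` (?A1 \<union> ?A2) \<union> ?f ` ?A3"
    unfolding margin_class_monomials[OF d disj] by (simp add: image_Un)
  moreover have "inj_on ?f ?A3" by (auto simp: inj_on_def)
  ultimately have total: "card (?M ` monomials (R \<times> (C1 \<union> C2)) d) = card ?A1 + card ?A2 + card ?A3"
    using fins c12 by (simp add: card_Un_disjoint card_image)
  let ?B = "monomials C1 d \<union> monomials C2 d" and ?U = "monomials (C1 \<union> C2) d"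
  have "finite ?U" "?B \<subseteq> ?U"
    using fins by (auto simp: monomials_def)
  then have "card ?B + card (?U - ?B) = card ?U"
    using card_Diff_subset[of ?B ?U] card_mono[of ?U ?B] finite_subset[of ?B ?U] by linarith
  moreover have "card ?B = card (monomials C1 d) + card (monomials C2 d)"
    using fins monomials_disjoint[OF d disj] by (simp add: card_Un_disjoint)
  moreover have "?U - ?B = ?U - monomials C1 d - monomials C2 d" by blast
  ultimately have "card ?U = card (monomials C1 d) + card (monomials C2 d)
      + card (?U - monomials C1 d - monomials C2 d)"
    by simp
  then show ?thesis
    unfolding total card_cartesian_product by (simp only: distrib_left add.assoc)
qed

section \<open>Ideals generated by differences of monomials\<close>

lemma push_plus: "push ((+) u) p = Poly_Mapping.single u 1 * p" for p :: "('v, 'k::field) mpol"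
proof -
  have "Poly_Mapping.single u 1 * p = Poly_Mapping.single u 1 * push (\<lambda>t. t) p"
    by (simp add: push_ident)
  then show ?thesis by (simp add: push_def sum_distrib_left mult_single)
qed

text \<open>By \<open>cong\<close>, multiplication by a monomial induces a map on classes, so it
  preserves the kernel.\<close>

lemma ideal_push_kernel:
  fixes \<phi> :: "('v \<Rightarrow>\<^sub>0 nat) \<Rightarrow> 'b"
  assumes cong: "\<And>s t u. \<phi> s = \<phi> t \<Longrightarrow> \<phi> (u + s) = \<phi> (u + t)"
  shows "ideal {p \<in> carrier (mpol_ring V). push \<phi> p = 0} (mpol_ring V :: ('v, 'k::field) mpol ring)"
proof (rule ideal_mpol_ringI)
  fix p x :: "('v, 'k) mpol"
  assume p: "p \<in> {p \<in> carrier (mpol_ring V). push \<phi> p = 0}" and x: "x \<in> carrier (mpol_ring V)"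
  have single0: "push \<phi> (Poly_Mapping.single u c * p) = 0" for u c
  proof -
    let ?q = "mpol_const c * p"
    define \<alpha> where "\<alpha> y = \<phi> (u + (SOME t. \<phi> t = y))" for y
    have "\<phi> (u + t) = \<alpha> (\<phi> t)" for t
      unfolding \<alpha>_def by (rule cong) (rule someI[of "\<lambda>s. \<phi> s = \<phi> t" t, symmetric, OF refl])
    then have "\<phi> \<circ> (+) u = \<alpha> \<circ> \<phi>" by auto
    moreover have "push \<phi> ?q = 0"
      using p by (intro poly_mapping_eqI) (simp add: lookup_push_mpol_const_mult)
    ultimately have "push \<phi> (push ((+) u) ?q) = 0"
      by (metis push_push push_zero)
    moreover have "push ((+) u) ?q = Poly_Mapping.single u c * p"
      by (simp add: push_plus mpol_const_def mult_single flip: mult.assoc)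
    ultimately show ?thesis by simp
  qed
  have "x * p = push (\<lambda>t. t) x * p" by (simp add: push_ident)
  then have "push \<phi> (x * p) = 0"
    by (simp add: push_def[of _ x] sum_distrib_right push_sum single0)
  then show "x * p \<in> {p \<in> carrier (mpol_ring V). push \<phi> p = 0}"
    using p x by (simp add: carrier_mpol_ring_closed)
qed (auto simp: push_add carrier_mpol_ring_closed)

definition monomials_congruent :: "('v, 'k::field) mpol set \<Rightarrow> ('v \<Rightarrow>\<^sub>0 nat) \<Rightarrow> ('v \<Rightarrow>\<^sub>0 nat) \<Rightarrow> bool" where
  "monomials_congruent J s t \<longleftrightarrow> Poly_Mapping.single s 1 - Poly_Mapping.single t 1 \<in> J"

lemma monomials_congruent_refl: "ideal J (mpol_ring V) \<Longrightarrow> monomials_congruent J t t"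
  by (simp add: monomials_congruent_def ideal_mpol_ringD)

lemma monomials_congruent_sym:
  assumes "ideal J (mpol_ring V)" "monomials_congruent J s t"
  shows "monomials_congruent J t s"
  using ideal_mpol_ringD(4)[OF assms(1), of _ "- 1"] carrier_mpol_ring_closed(3)[of 1 V 1] assms(2)
  unfolding monomials_congruent_def by fastforce

lemma monomials_congruent_trans:
  assumes "ideal J (mpol_ring V)" "monomials_congruent J s t" "monomials_congruent J t u"
  shows "monomials_congruent J s u"
  using ideal_mpol_ringD(3)[OF assms(1)] assms(2,3) unfolding monomials_congruent_def by fastforce

lemma monomials_congruent_add:
  assumes "ideal J (mpol_ring V)" "monomials_congruent J s t" "Poly_Mapping.keys u \<subseteq> V"
  shows "monomials_congruent J (s + u) (t + u)"
proof -
  have "(Poly_Mapping.single s 1 - Poly_Mapping.single t 1) * Poly_Mapping.single u 1 \<in> J"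
    using ideal_mpol_ringD(5)[OF assms(1)] assms(2) monomial_in_carrier[OF assms(3)]
    unfolding monomials_congruent_def by blast
  then show ?thesis
    by (simp add: monomials_congruent_def left_diff_distrib mult_single)
qed

text \<open>Replacing each monomial by the representative of its class changes \<open>p\<close> by a
  combination of differences that lie in \<open>J\<close>.\<close>

lemma ideal_mem_if_push_zero:
  fixes J :: "('v, 'k::field) mpol set"
  assumes J: "ideal J (mpol_ring V)"
    and cong: "\<And>s t. Poly_Mapping.keys s \<subseteq> V \<Longrightarrow> Poly_Mapping.keys t \<subseteq> V \<Longrightarrow> \<phi> s = \<phi> t \<Longrightarrow> monomials_congruent J s t"
    and p: "p \<in> carrier (mpol_ring V)" "push \<phi> p = 0"
  shows "p \<in> J"
proof -
  define r where "r x = (SOME t. Poly_Mapping.keys t \<subseteq> V \<and> \<phi> t = x)" for x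
  have r: "Poly_Mapping.keys (r (\<phi> t)) \<subseteq> V" "\<phi> (r (\<phi> t)) = \<phi> t" if "Poly_Mapping.keys t \<subseteq> V" for t
    using someI[of "\<lambda>s. Poly_Mapping.keys s \<subseteq> V \<and> \<phi> s = \<phi> t" t] that by (auto simp: r_def)
  \<comment> \<open>The replaced polynomial factors through \<open>push \<phi> p\<close> and
    therefore vanishes.\<close>
  have "push (r \<circ> \<phi>) p = 0" using p(2) by (metis push_push push_zero)
  then have "p = push (\<lambda>t. t) p - push (r \<circ> \<phi>) p" by (simp add: push_ident)
  also have "\<dots> = (\<Sum>t\<in>Poly_Mapping.keys p. mpol_const (Poly_Mapping.lookup p t) *
      (Poly_Mapping.single t 1 - Poly_Mapping.single (r (\<phi> t)) 1))"
    by (simp add: push_def sum_subtractf right_diff_distrib mpol_const_def mult_single)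
  finally have eq: "p = \<dots>" .
  have "(\<Sum>t\<in>T. mpol_const (Poly_Mapping.lookup p t) *
      (Poly_Mapping.single t 1 - Poly_Mapping.single (r (\<phi> t)) 1)) \<in> J" if "T \<subseteq> Poly_Mapping.keys p" for T
    using finite_subset[OF that finite_keys] that
  proof (induction T rule: finite_induct)
    case empty
    then show ?case using ideal_mpol_ringD(2)[OF J] by simp
  next
    case (insert t T)
    then have "Poly_Mapping.keys t \<subseteq> V" using p(1) by (auto simp: mem_carrier_mpol_ring)
    then have "Poly_Mapping.single t 1 - Poly_Mapping.single (r (\<phi> t)) 1 \<in> J"
      using cong[of t "r (\<phi> t)"] r[of t] unfolding monomials_congruent_def by simp
    note summand = ideal_mpol_ringD(4)[OF J this mpol_const_in_carrier]
    show ?case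
      unfolding sum.insert[OF insert.hyps]
      by (rule ideal_mpol_ringD(3)[OF J summand insert.IH]) (use insert.prems in simp)
  qed
  from this[OF subset_refl] show ?thesis by (subst eq)
qed

abbreviation (input) cell :: "'a \<Rightarrow> 'b \<Rightarrow> ('a \<times> 'b) \<Rightarrow>\<^sub>0 nat" where
  "cell i k \<equiv> Poly_Mapping.single (i, k) 1"

text \<open>Generators swap two cells in columns of different parts; a third cell in the other part makes
  it possible to swap two cells in columns of the same part, in three moves.\<close>

locale column_swap =
  fixes R :: "'a set" and C1 C2 :: "'b set" and J :: "('a \<times> 'b, 'k::field) mpol set"
  assumes J: "ideal J (mpol_ring (R \<times> (C1 \<union> C2)))"
    and swap: "i \<in> R \<Longrightarrow> j \<in> R \<Longrightarrow> k \<in> C1 \<Longrightarrow> l \<in> C2 \<Longrightarrow>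
      monomials_congruent J (cell i k + cell j l) (cell i l + cell j k)"
begin

abbreviation (input) "V \<equiv> R \<times> (C1 \<union> C2)"

lemma swap_opposite:
  assumes "i \<in> R" "j \<in> R" "k \<in> C1 \<and> l \<in> C2 \<or> k \<in> C2 \<and> l \<in> C1" "Poly_Mapping.keys s \<subseteq> V"
  shows "monomials_congruent J (cell i k + cell j l + s) (cell i l + cell j k + s)"
proof (rule monomials_congruent_add[OF J _ assms(4)])
  show "monomials_congruent J (cell i k + cell j l) (cell i l + cell j k)"
    using swap[of i j k l] swap[of j i l k] assms(1-3) by (auto simp: add.commute)
qed

lemma swap_same_side:
  assumes ij: "i \<in> R" "j \<in> R" and s: "Poly_Mapping.keys s \<subseteq> V" and pq: "(p, q) \<in> Poly_Mapping.keys s"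
    and opp: "{k, l} \<subseteq> C1 \<and> q \<in> C2 \<or> {k, l} \<subseteq> C2 \<and> q \<in> C1"
  shows "monomials_congruent J (cell i k + cell j l + s) (cell i l + cell j k + s)"
proof -
  obtain s' where s': "s = cell p q + s'"
    using single_le_split[of s "(p, q)"] pq by (auto simp: in_keys_iff)
  have keys: "Poly_Mapping.keys s' \<subseteq> V" and p: "p \<in> R"
    using s pq by (auto simp: s' keys_add_nat)
  have kl: "k \<in> C1 \<union> C2" "l \<in> C1 \<union> C2" using opp by auto
  \<comment> \<open>The helper \<open>(p, q)\<close> first takes column \<open>k\<close> from row
    \<open>i\<close>, then rows \<open>i\<close> and \<open>j\<close> trade \<open>q\<close> and
    \<open>l\<close>, and last row \<open>j\<close> receives \<open>k\<close> while the helper is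
    restored.\<close>
  have "monomials_congruent J (cell i k + cell p q + (cell j l + s')) (cell i q + cell p k + (cell j l + s'))"
    by (rule swap_opposite) (use ij p opp keys kl in \<open>auto simp: keys_add_nat\<close>)
  moreover have "monomials_congruent J (cell i q + cell j l + (cell p k + s')) (cell i l + cell j q + (cell p k + s'))"
    by (rule swap_opposite) (use ij p opp keys kl in \<open>auto simp: keys_add_nat\<close>)
  moreover have "monomials_congruent J (cell j q + cell p k + (cell i l + s')) (cell j k + cell p q + (cell i l + s'))"
    by (rule swap_opposite) (use ij p opp keys kl in \<open>auto simp: keys_add_nat\<close>)
  ultimately have "monomials_congruent J (cell i k + cell j l + s) (cell i q + cell j l + (cell p k + s'))"
    "monomials_congruent J (cell i q + cell j l + (cell p k + s')) (cell i l + cell j q + (cell p k + s'))"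
    "monomials_congruent J (cell i l + cell j q + (cell p k + s')) (cell i l + cell j k + s)"
    by (simp_all only: s' ac_simps)
  then show ?thesis by (blast intro: monomials_congruent_trans[OF J])
qed

lemma swap_mixed:
  assumes keys: "Poly_Mapping.keys (cell i k + cell j l + s) \<subseteq> V"
    and mixed: "meets_both C1 C2 (push snd (cell i k + cell j l + s))"
  shows "monomials_congruent J (cell i k + cell j l + s) (cell i l + cell j k + s)"
proof -
  have ij: "i \<in> R" "j \<in> R" and kl: "k \<in> C1 \<union> C2" "l \<in> C1 \<union> C2" and s: "Poly_Mapping.keys s \<subseteq> V"
    using keys by (auto simp: keys_add_nat)
  have cols: "Poly_Mapping.keys (push snd (cell i k + cell j l + s)) = {k, l} \<union> snd ` Poly_Mapping.keys s"
    by (simp add: keys_push_nat keys_add_nat image_Un insert_commute)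
  consider "k \<in> C1 \<and> l \<in> C2 \<or> k \<in> C2 \<and> l \<in> C1"
    | p q where "(p, q) \<in> Poly_Mapping.keys s" "{k, l} \<subseteq> C1 \<and> q \<in> C2 \<or> {k, l} \<subseteq> C2 \<and> q \<in> C1"
    using mixed kl unfolding meets_both_def cols by fastforce
  then show ?thesis
  proof cases
    case 1
    then show ?thesis by (rule swap_opposite[OF ij _ s])
  next
    case 2
    then show ?thesis by (rule swap_same_side[OF ij s])
  qed
qed

text \<open>One swap brings a cell of \<open>y\<close> into \<open>x\<close>, after which the common
  cell is handed over to \<open>u\<close>. Keeping the matched cells in \<open>u\<close> preserves
  the mixed support of the whole monomial while \<open>x\<close> and \<open>y\<close>
  shrink.\<close>

lemma congruent_if_same_margins:
  assumes "Poly_Mapping.keys u \<subseteq> V" "Poly_Mapping.keys x \<subseteq> V" "Poly_Mapping.keys y \<subseteq> V"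
    and "push fst x = push fst y" "push snd x = push snd y" "meets_both C1 C2 (push snd (u + x))"
  shows "monomials_congruent J (u + x) (u + y)"
  using assms
proof (induction "mono_degree x" arbitrary: u x y)
  case 0
  then have "mono_degree y = 0" by (metis mono_degree_push)
  then show ?case using 0 by (simp add: mono_degree_eq_0_iff monomials_congruent_refl[OF J])
next
  case (Suc d)
  then have "x \<noteq> 0" by auto
  then have "Poly_Mapping.keys x \<noteq> {}" by simp
  \<comment> \<open>Equal margins give a row \<open>j\<close> where \<open>y\<close> uses column
    \<open>k\<close>, and then a column \<open>l\<close> where \<open>x\<close> uses row
    \<open>j\<close>. Swapping \<open>(i, k)\<close> and \<open>(j, l)\<close> creates
    \<open>(j, k)\<close>.\<close>
  then obtain i k where ik: "(i, k) \<in> Poly_Mapping.keys x" by (metis all_not_in_conv surj_pair)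
  then have "k \<in> snd ` Poly_Mapping.keys y" using Suc.prems(5) by (metis imageI keys_push_nat snd_conv)
  then obtain j where jk: "(j, k) \<in> Poly_Mapping.keys y" by auto
  then have "j \<in> fst ` Poly_Mapping.keys x" using Suc.prems(4) by (metis imageI keys_push_nat fst_conv)
  then obtain l where jl: "(j, l) \<in> Poly_Mapping.keys x" by auto
  obtain y' where y': "y = cell j k + y'"
    using single_le_split[of y "(j, k)"] jk by (auto simp: in_keys_iff)
  show ?case
  proof (cases "(j, k) \<in> Poly_Mapping.keys x")
    case True
    then obtain x' where x': "x = cell j k + x'"
      using single_le_split[of x "(j, k)"] by (auto simp: in_keys_iff)
    have "monomials_congruent J (u + cell j k + x') (u + cell j k + y')"
      by (rule Suc.hyps(1))
         (use Suc.prems Suc.hyps(2) in \<open>auto simp: x' y' keys_add_nat mono_degree_add push_add add.assoc\<close>)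
    then show ?thesis by (simp add: x' y' add.assoc)
  next
    case False
    obtain x1 where x1: "x = cell i k + x1"
      using single_le_split[of x "(i, k)"] ik by (auto simp: in_keys_iff)
    \<comment> \<open>The two cells to be swapped are distinct, so both can be split off
      \<open>x\<close> even if each has exponent 1.\<close>
    have "(i, k) \<noteq> (j, l)" using False ik jl by auto
    then have "Poly_Mapping.lookup x1 (j, l) \<noteq> 0"
      using jl by (auto simp: x1 in_keys_iff lookup_add lookup_single when_def split: if_splits)
    then obtain x' where x': "x1 = cell j l + x'" by (rule single_le_split)
    have keys: "Poly_Mapping.keys (cell i k + cell j l + (x' + u)) \<subseteq> V"
      using Suc.prems(1,2) by (auto simp: x1 x' keys_add_nat)
    have "monomials_congruent J (cell i k + cell j l + (x' + u)) (cell i l + cell j k + (x' + u))"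
      by (rule swap_mixed[OF keys]) (use Suc.prems(6) in \<open>simp add: x1 x' ac_simps\<close>)
    moreover have "monomials_congruent J (u + cell j k + (cell i l + x')) (u + cell j k + y')"
    proof (rule Suc.hyps(1))
      show "d = mono_degree (cell i l + x')"
        using Suc.hyps(2) by (simp add: x1 x' mono_degree_add)
      have "Poly_Mapping.single j 1 + push fst (cell i l + x') = Poly_Mapping.single j 1 + push fst y'"
        using Suc.prems(4) by (simp add: x1 x' y' push_add ac_simps)
      then show "push fst (cell i l + x') = push fst y'" by (rule add_left_imp_eq)
      show "push snd (cell i l + x') = push snd y'"
        using Suc.prems(5) by (simp add: x1 x' y' push_add)
      show "meets_both C1 C2 (push snd (u + cell j k + (cell i l + x')))"
        using Suc.prems(6) by (simp add: x1 x' push_add add.assoc add.left_commute)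
    qed (use keys Suc.prems in \<open>auto simp: y' keys_add_nat\<close>)
    ultimately have "monomials_congruent J (u + x) (cell i l + cell j k + (x' + u))"
      "monomials_congruent J (cell i l + cell j k + (x' + u)) (u + y)"
      by (simp_all only: x1 x' y' ac_simps)
    then show ?thesis by (rule monomials_congruent_trans[OF J])
  qed
qed

lemma congruent_if_same_margin_class:
  assumes "Poly_Mapping.keys s \<subseteq> V" "Poly_Mapping.keys t \<subseteq> V" "margin_class C1 C2 s = margin_class C1 C2 t"
  shows "monomials_congruent J s t"
proof (cases "meets_both C1 C2 (push snd s)")
  case True
  then show ?thesis
    using congruent_if_same_margins[of 0 s t] assms margin_class_eqD[OF assms(3)] by simp
next
  case False
  then show ?thesis
    using margin_class_eqD(3)[OF assms(3)] monomials_congruent_refl[OF J] by simp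
qed

end

section \<open>The complete bipartite graph\<close>

context
  fixes m n1 n2 :: nat
  assumes m: "1 \<le> m" and n1: "1 \<le> n1" and n2: "1 \<le> n2"
begin

abbreviation (input) "rows \<equiv> {1..m}"
abbreviation (input) "left_cols \<equiv> {1..n1}"
abbreviation (input) "right_cols \<equiv> {n1+1..n1+n2}"
abbreviation (input) "vars \<equiv> matrix_vars m (n1 + n2)"
abbreviation (input) bipartite_ideal :: "(nat \<times> nat, 'k::field) mpol set" where
  "bipartite_ideal \<equiv> gen_binomial_edge_ideal m (n1 + n2) (complete_bipartite_edges n1 n2)"

definition bipartite_minors :: "(nat \<times> nat, 'k::field) mpol set" where
  "bipartite_minors = {mpol_var (i, k) * mpol_var (j, l) - mpol_var (i, l) * mpol_var (j, k) | i j k l.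
     i \<in> rows \<and> j \<in> rows \<and> i < j \<and> k \<in> left_cols \<and> l \<in> right_cols}"

lemma vars_eq: "vars = rows \<times> (left_cols \<union> right_cols)"
  by (auto simp: matrix_vars_def)

text \<open>Left columns carry the smaller numbers, so \<open>k < l\<close> orients every edge from
  left to right.\<close>

lemma bipartite_ideal_eq:
  "(bipartite_ideal :: (nat \<times> nat, 'k::field) mpol set) = Idl\<^bsub>mpol_ring vars\<^esub> bipartite_minors"
proof -
  have edge: "{k, l} \<in> complete_bipartite_edges n1 n2 \<and> k < l \<longleftrightarrow> k \<in> left_cols \<and> l \<in> right_cols" for k l
    by (auto simp: complete_bipartite_edges_def doubleton_eq_iff)
  have "1 \<le> i \<and> i < j \<and> j \<le> m \<and> {k, l} \<in> complete_bipartite_edges n1 n2 \<and> k < l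
      \<longleftrightarrow> i \<in> rows \<and> j \<in> rows \<and> i < j \<and> k \<in> left_cols \<and> l \<in> right_cols" for i j k l
    unfolding edge by auto
  then show ?thesis
    unfolding gen_binomial_edge_ideal_def bipartite_minors_def by simp
qed

lemma bipartite_minors_subset: "bipartite_minors \<subseteq> carrier (mpol_ring vars :: (nat \<times> nat, 'k::field) mpol ring)"
  by (auto simp: bipartite_minors_def vars_eq
      intro!: carrier_mpol_ring_closed mpol_var_in_carrier)

lemma ideal_bipartite_ideal:
  "ideal (bipartite_ideal :: (nat \<times> nat, 'k::field) mpol set) (mpol_ring vars)"
  unfolding bipartite_ideal_eq
  by (rule ring.genideal_ideal[OF cring.axioms(1)[OF mpol_ring_cring] bipartite_minors_subset])

lemma bipartite_ideal_minimal:
  assumes "ideal I (mpol_ring vars)" "bipartite_minors \<subseteq> I"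
  shows "(bipartite_ideal :: (nat \<times> nat, 'k::field) mpol set) \<subseteq> I"
  unfolding bipartite_ideal_eq
  by (rule ring.genideal_minimal[OF cring.axioms(1)[OF mpol_ring_cring] assms])

lemma bipartite_minors_subset_ideal: "bipartite_minors \<subseteq> (bipartite_ideal :: (nat \<times> nat, 'k::field) mpol set)"
  unfolding bipartite_ideal_eq
  by (rule ring.genideal_self[OF cring.axioms(1)[OF mpol_ring_cring] bipartite_minors_subset])

lemma var_mult_var: "mpol_var v * mpol_var w = Poly_Mapping.single (Poly_Mapping.single v 1 + Poly_Mapping.single w 1) 1"
  by (simp add: mpol_var_def mult_single)

lemma bipartite_column_swap:
  "column_swap rows left_cols right_cols (bipartite_ideal :: (nat \<times> nat, 'k::field) mpol set)"
proof (rule column_swap.intro)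
  show J: "ideal (bipartite_ideal :: (nat \<times> nat, 'k::field) mpol set) (mpol_ring (rows \<times> (left_cols \<union> right_cols)))"
    using ideal_bipartite_ideal unfolding vars_eq .
  fix i j k l assume ij: "i \<in> rows" "j \<in> rows" and kl: "k \<in> left_cols" "l \<in> right_cols"
  have less: "monomials_congruent (bipartite_ideal :: (nat \<times> nat, 'k::field) mpol set)
      (cell i k + cell j l) (cell i l + cell j k)"
    if "i \<in> rows" "j \<in> rows" "i < j" for i j
    using bipartite_minors_subset_ideal that kl
    unfolding monomials_congruent_def bipartite_minors_def var_mult_var by blast
  \<comment> \<open>Only \<open>i < j\<close> is a generator; equal rows make the swap trivial, and
    reversed rows use symmetry.\<close>
  consider "i < j" | "i = j" | "j < i" by linarith
  then show "monomials_congruent (bipartite_ideal :: (nat \<times> nat, 'k::field) mpol set)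
      (cell i k + cell j l) (cell i l + cell j k)"
  proof cases
    case 1
    then show ?thesis using less ij by blast
  next
    case 2
    then show ?thesis using monomials_congruent_refl[OF J] by (simp add: add.commute)
  next
    case 3
    then show ?thesis
      using monomials_congruent_sym[OF J less[OF ij(2,1)]] by (simp add: add.commute)
  qed
qed

text \<open>Forwards, the minors lie in the kernel, which is an ideal. Backwards, swaps connect all
  monomials of one class.\<close>

lemma mem_bipartite_ideal_iff:
  fixes p :: "(nat \<times> nat, 'k::field) mpol"
  assumes "p \<in> carrier (mpol_ring vars)"
  shows "p \<in> bipartite_ideal \<longleftrightarrow> push (margin_class left_cols right_cols) p = 0"
proof
  let ?\<phi> = "margin_class left_cols right_cols :: (nat \<times> nat \<Rightarrow>\<^sub>0 nat) \<Rightarrow> _"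
  let ?K = "{p \<in> carrier (mpol_ring vars :: (nat \<times> nat, 'k) mpol ring). push ?\<phi> p = 0}"
  have "bipartite_minors \<subseteq> ?K"
  proof
    fix g :: "(nat \<times> nat, 'k) mpol" assume g: "g \<in> bipartite_minors"
    then obtain i j k l where
      eq: "g = mpol_var (i, k) * mpol_var (j, l) - mpol_var (i, l) * mpol_var (j, k)"
      and kl: "k \<in> left_cols" "l \<in> right_cols"
      unfolding bipartite_minors_def by blast
    have "?\<phi> (cell i k + cell j l) = ?\<phi> (cell i l + cell j k)"
      using kl by (simp add: margin_class_def push_add meets_both_def keys_add_nat add.commute)
    then show "g \<in> ?K"
      using g bipartite_minors_subset unfolding eq var_mult_var by (auto simp: push_diff)
  qed
  then have "bipartite_ideal \<subseteq> ?K"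
    by (intro bipartite_ideal_minimal ideal_push_kernel) (rule margin_class_add_cong)
  then show "p \<in> bipartite_ideal \<Longrightarrow> push ?\<phi> p = 0" by blast
  interpret column_swap rows left_cols right_cols "bipartite_ideal :: (nat \<times> nat, 'k) mpol set"
    by (rule bipartite_column_swap)
  show "push ?\<phi> p = 0 \<Longrightarrow> p \<in> bipartite_ideal"
    using ideal_mem_if_push_zero[OF J congruent_if_same_margin_class] assms unfolding vars_eq by blast
qed

section \<open>Number of classes and its growth\<close>

lemma card_bipartite_classes:
  "card (margin_class left_cols right_cols ` monomials vars d)
      + ((m - 1 + d) choose d) * (((n1 - 1 + d) choose d) + ((n2 - 1 + d) choose d))
    = ((m * n1 - 1 + d) choose d) + ((m * n2 - 1 + d) choose d)
      + ((m - 1 + d) choose d) * ((n1 + n2 - 1 + d) choose d)"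
proof -
  have ne: "rows \<noteq> {}" "left_cols \<noteq> {}" "right_cols \<noteq> {}" using m n1 n2 by auto
  have "card (left_cols \<union> right_cols) = n1 + n2" by (subst card_Un_disjoint) auto
  then show ?thesis
    using card_margin_class_monomials[of rows left_cols right_cols d] ne
    by (simp add: vars_eq card_monomials)
qed

text \<open>The constant 3 counts the positive terms of the formula; the subtracted ones are
  dropped.\<close>

lemma card_bipartite_classes_le:
  "card (margin_class left_cols right_cols ` monomials vars d) \<le> 3 * (d + 1) ^ (max (m * n2) (max (m * n1) (m + n1 + n2 - 1)) - 1)"
proof -
  let ?D = "max (m * n2) (max (m * n1) (m + n1 + n2 - 1)) - 1"
  have le: "(a + d) choose d \<le> (d + 1) ^ ?D" if "a \<le> ?D" for a
    using binomial_le_power[of a d] power_increasing[OF that, of "d + 1"] by simp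
  have "((m - 1 + d) choose d) * ((n1 + n2 - 1 + d) choose d) \<le> (d + 1) ^ (m - 1) * (d + 1) ^ (n1 + n2 - 1)"
    by (intro mult_mono binomial_le_power) auto
  also have "\<dots> \<le> (d + 1) ^ ?D"
    unfolding power_add[symmetric] using m n1 by (intro power_increasing) auto
  finally have rank1: "((m - 1 + d) choose d) * ((n1 + n2 - 1 + d) choose d) \<le> (d + 1) ^ ?D" .
  have "(m * n1 - 1 + d) choose d \<le> (d + 1) ^ ?D" "(m * n2 - 1 + d) choose d \<le> (d + 1) ^ ?D"
    by (intro le diff_le_mono; simp)+
  note bounds = add_mono[OF add_mono[OF this] rank1]
  have "card (margin_class left_cols right_cols ` monomials vars d) \<le> ((m * n1 - 1 + d) choose d)
      + ((m * n2 - 1 + d) choose d) + ((m - 1 + d) choose d) * ((n1 + n2 - 1 + d) choose d)"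
    by (metis card_bipartite_classes le_add1)
  also note bounds
  finally show ?thesis by simp
qed

lemma card_bipartite_classes_cumulative:
  "card (margin_class left_cols right_cols ` {t. Poly_Mapping.keys t \<subseteq> vars \<and> mono_degree t \<le> d})
    \<le> 3 * (d + 1) ^ max (m * n2) (max (m * n1) (m + n1 + n2 - 1))"
proof -
  let ?\<phi> = "margin_class left_cols right_cols :: (nat \<times> nat \<Rightarrow>\<^sub>0 nat) \<Rightarrow> _"
  let ?D = "max (m * n2) (max (m * n1) (m + n1 + n2 - 1))"
  have D: "0 < ?D" using m n1 by auto
  have "{t. Poly_Mapping.keys t \<subseteq> vars \<and> mono_degree t \<le> d} = (\<Union>e\<le>d. monomials vars e)"
    by (auto simp: monomials_def)
  then have "card (?\<phi> ` {t. Poly_Mapping.keys t \<subseteq> vars \<and> mono_degree t \<le> d}) \<le> (\<Sum>e\<le>d. card (?\<phi> ` monomials vars e))"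
    using card_UN_le[of "{..d}" "\<lambda>e. ?\<phi> ` monomials vars e"] by (simp add: image_UN)
  also have "\<dots> \<le> (\<Sum>e\<le>d. 3 * (d + 1) ^ (?D - 1))"
    by (intro sum_mono order_trans[OF card_bipartite_classes_le] mult_left_mono power_mono) auto
  also have "\<dots> = 3 * ((d + 1) * (d + 1) ^ (?D - 1))" by simp
  also have "(d + 1) * (d + 1) ^ (?D - 1) = (d + 1) ^ ?D"
    using D by (metis power_eq_if not_less0)
  finally show ?thesis .
qed

text \<open>Any matrix \<open>a\<close> of parameter polynomials on which the minors vanish yields
  primes above the ideal. Each truncation level is witnessed by an entry that dies exactly
  there.\<close>

lemma truncation_kernel_chain:
  fixes a :: "nat \<times> nat \<Rightarrow> (nat, 'k::field) mpol"
  assumes minors: "\<And>i j k l. i \<in> rows \<Longrightarrow> j \<in> rows \<Longrightarrow> k \<in> left_cols \<Longrightarrow> l \<in> right_cols \<Longrightarrow>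
      a (i, k) * a (j, l) = a (i, l) * a (j, k)"
    and steps: "\<And>k. lo \<le> k \<Longrightarrow> k < lo + D \<Longrightarrow> \<exists>v\<in>vars.
      mpol_subst (truncated_vars (Suc k)) (a v) \<noteq> 0 \<and> mpol_subst (truncated_vars k) (a v) = 0"
  shows "\<exists>Q :: nat \<Rightarrow> (nat \<times> nat, 'k) mpol set. (\<forall>i\<le>D. primeideal (Q i) (mpol_ring vars)) \<and>
    (\<forall>i<D. Q i \<subset> Q (Suc i)) \<and> bipartite_ideal \<subseteq> Q 0"
proof -
  \<comment> \<open>Lower levels give larger kernels, so the index is reversed; the chain ends at
    level \<open>lo\<close>.\<close>
  define Q where "Q i = truncation_kernel vars a (lo + D - i)" for i
  have "primeideal (Q i) (mpol_ring vars)" for i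
    unfolding Q_def by (rule primeideal_truncation_kernel)
  moreover have "Q i \<subset> Q (Suc i)" if i: "i < D" for i
  proof -
    have "lo + D - i = Suc (lo + D - Suc i)" using i by simp
    moreover have "lo \<le> lo + D - Suc i" "lo + D - Suc i < lo + D" using i by linarith+
    from steps[OF this] obtain v where "v \<in> vars" "mpol_subst (truncated_vars (Suc (lo + D - Suc i))) (a v) \<noteq> 0"
      "mpol_subst (truncated_vars (lo + D - Suc i)) (a v) = 0"
      by blast
    ultimately show ?thesis unfolding Q_def by (metis truncation_kernel_strict)
  qed
  moreover have "bipartite_ideal \<subseteq> Q 0"
  proof (rule bipartite_ideal_minimal)
    show "ideal (Q 0) (mpol_ring vars)"
      unfolding Q_def by (rule primeideal.axioms(1)[OF primeideal_truncation_kernel])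
    show "bipartite_minors \<subseteq> Q 0"
    proof
      fix g :: "(nat \<times> nat, 'k) mpol" assume g: "g \<in> bipartite_minors"
      then obtain i j k l where ijkl: "i \<in> rows" "j \<in> rows" "k \<in> left_cols" "l \<in> right_cols"
        and eq: "g = mpol_var (i, k) * mpol_var (j, l) - mpol_var (i, l) * mpol_var (j, k)"
        unfolding bipartite_minors_def by blast
      have "mpol_subst a g = 0"
        unfolding eq using minors[OF ijkl] by (simp add: mpol_subst_diff mpol_subst_mult)
      then show "g \<in> Q 0"
        using g bipartite_minors_subset by (auto simp: Q_def truncation_kernel_def)
    qed
  qed
  ultimately show ?thesis by blast
qed

lemma truncated_vars_simps:
  "i < k \<Longrightarrow> truncated_vars k i = mpol_var i" "k \<le> i \<Longrightarrow> truncated_vars k i = 0"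
  by (simp_all add: truncated_vars_def)

lemma mpol_var_nonzero: "mpol_var v \<noteq> (0 :: ('v, 'k::field) mpol)"
  by (metis lookup_single_eq lookup_zero mpol_var_def zero_neq_one)

text \<open>Here the variables of the left columns vanish.\<close>

lemma prime_chain_right_cols:
  "\<exists>Q :: nat \<Rightarrow> (nat \<times> nat, 'k::field) mpol set. (\<forall>i\<le>m * n2. primeideal (Q i) (mpol_ring vars)) \<and>
    (\<forall>i<m * n2. Q i \<subset> Q (Suc i)) \<and> bipartite_ideal \<subseteq> Q 0"
proof (rule truncation_kernel_chain)
  \<comment> \<open>The entries of the right columns are numbered row by row from 0, so division
    with remainder by \<open>n2\<close> recovers the entry with number \<open>k\<close>.\<close>
  define a :: "nat \<times> nat \<Rightarrow> (nat, 'k) mpol"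
    where "a = (\<lambda>(i, j). if j \<le> n1 then 0 else mpol_var ((i - 1) * n2 + (j - n1 - 1)))"
  show "a (i, k) * a (j, l) = a (i, l) * a (j, k)" if "k \<in> left_cols" for i j k l
    using that by (simp add: a_def)
  fix k assume "k < 0 + m * n2"
  then have k: "k div n2 < m" "k mod n2 < n2"
    using n2 by (simp_all add: less_mult_imp_div_less)
  have "a (k div n2 + 1, n1 + 1 + k mod n2) = mpol_var k" by (simp add: a_def)
  moreover have "(k div n2 + 1, n1 + 1 + k mod n2) \<in> vars"
    using k by (auto simp: matrix_vars_def)
  ultimately show "\<exists>v\<in>vars. mpol_subst (truncated_vars (Suc k)) (a v) \<noteq> 0 \<and> mpol_subst (truncated_vars k) (a v) = 0"
    by (intro bexI) (auto simp: truncated_vars_simps mpol_var_nonzero)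
qed

text \<open>The matrices of rank at most one are parametrized by \<open>x (i, j) = y i * z j\<close>; the variables are
  numbered \<open>y 1, z 1, \<dots>, z (n1 + n2), y 2, \<dots>, y m\<close> from 0, and \<open>y 1\<close> is kept to the end.\<close>

lemma prime_chain_rank_one:
  "\<exists>Q :: nat \<Rightarrow> (nat \<times> nat, 'k::field) mpol set. (\<forall>i\<le>m + n1 + n2 - 1. primeideal (Q i) (mpol_ring vars)) \<and>
    (\<forall>i<m + n1 + n2 - 1. Q i \<subset> Q (Suc i)) \<and> bipartite_ideal \<subseteq> Q 0"
proof (rule truncation_kernel_chain)
  define y where "y i = (if i = 1 then 0 else n1 + n2 + i - 1)" for i
  define a :: "nat \<times> nat \<Rightarrow> (nat, 'k) mpol" where "a = (\<lambda>(i, j). mpol_var (y i) * mpol_var j)"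
  show "a (i, k) * a (j, l) = a (i, l) * a (j, k)" for i j k l
    by (simp add: a_def ac_simps)
  \<comment> \<open>There are \<open>m + n1 + n2\<close> parameters, but level 1 already kills every
    entry, so the chain stops there and has one step fewer.\<close>
  fix k assume k: "1 \<le> k" "k < 1 + (m + n1 + n2 - 1)"
  \<comment> \<open>The entry \<open>y 1 * z k\<close> in the first row, or \<open>y i * z 1\<close>
    in the first column with \<open>i = k - (n1 + n2) + 1\<close>; its other factor has number 0 or
    1 and survives.\<close>
  define v where "v = (if k \<le> n1 + n2 then (1, k) else (k - (n1 + n2) + 1, 1))"
  have "v \<in> vars" using k m n1 by (auto simp: v_def matrix_vars_def)
  moreover have "a v = mpol_var (if k \<le> n1 + n2 then 0 else 1) * mpol_var k"
    using k by (auto simp: a_def v_def y_def mult.commute)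
  moreover have "(if k \<le> n1 + n2 then 0 else 1) < k" using k n1 by auto
  ultimately show "\<exists>v\<in>vars. mpol_subst (truncated_vars (Suc k)) (a v) \<noteq> 0 \<and> mpol_subst (truncated_vars k) (a v) = 0"
    by (intro bexI[of _ v]) (simp_all add: mpol_subst_mult truncated_vars_simps mpol_var_nonzero)
qed

lemma krull_dim_bipartite:
  assumes "n1 \<le> n2"
  shows "krull_dim (mpol_ring vars Quot (bipartite_ideal :: (nat \<times> nat, 'k::field) mpol set))
    = enat (max (m * n2) (m + n1 + n2 - 1))"
proof -
  let ?D = "max (m * n2) (m + n1 + n2 - 1)"
  have D: "max (m * n2) (max (m * n1) (m + n1 + n2 - 1)) = ?D"
    using assms by (metis max.absorb1 max.assoc mult_le_mono2)
  have "\<exists>Q :: nat \<Rightarrow> (nat \<times> nat, 'k) mpol set. (\<forall>i\<le>?D. primeideal (Q i) (mpol_ring vars)) \<and>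
    (\<forall>i<?D. Q i \<subset> Q (Suc i)) \<and> bipartite_ideal \<subseteq> Q 0"
    using prime_chain_right_cols prime_chain_rank_one by (cases "m * n2 \<le> m + n1 + n2 - 1") (simp_all add: max_def)
  then obtain Q :: "nat \<Rightarrow> (nat \<times> nat, 'k) mpol set" where Q: "\<And>i. i \<le> ?D \<Longrightarrow> primeideal (Q i) (mpol_ring vars)"
    "\<And>i. i < ?D \<Longrightarrow> Q i \<subset> Q (Suc i)" "bipartite_ideal \<subseteq> Q 0"
    by blast
  show ?thesis
  proof (rule cring.krull_dim_quotient_eqI[OF mpol_ring_cring ideal_bipartite_ideal _ Q])
    fix P :: "nat \<Rightarrow> (nat \<times> nat, 'k) mpol set" and r
    assume P: "\<And>i. i \<le> r \<Longrightarrow> primeideal (P i) (mpol_ring vars)" "\<And>i. i < r \<Longrightarrow> P i \<subset> P (Suc i)"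
      "bipartite_ideal \<subseteq> P 0"
    show "r \<le> ?D"
    proof (rule prime_chain_length_le[where P = P and V = vars and C = 3 and \<phi> = "margin_class left_cols right_cols"])
      show "primeideal (P i) (mpol_ring vars)" if "i \<le> r" for i using P(1) that .
      show "P i \<subset> P (Suc i)" if "i < r" for i using P(2) that .
      show "finite vars" by (simp add: matrix_vars_def)
      show "p \<in> P 0" if "p \<in> carrier (mpol_ring vars)" "push (margin_class left_cols right_cols) p = 0" for p
        using that P(3) mem_bipartite_ideal_iff by blast
      have "{t. Poly_Mapping.keys t \<subseteq> vars \<and> mono_degree t \<le> d} = (\<Union>e\<le>d. monomials vars e)" for d
        by (auto simp: monomials_def)
      then show "finite {t. Poly_Mapping.keys t \<subseteq> vars \<and> mono_degree t \<le> d}" for d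
        using finite_monomials[OF \<open>finite vars\<close>] by simp
      show "card (margin_class left_cols right_cols ` {t. Poly_Mapping.keys t \<subseteq> vars \<and> mono_degree t \<le> d}) \<le> 3 * (d + 1) ^ ?D" for d
        using card_bipartite_classes_cumulative unfolding D .
    qed
  qed
qed

section \<open>Hilbert series of the quotient\<close>

lemma hilbert_series_bipartite:
  fixes J :: "(nat \<times> nat, 'k::field) mpol set"
  defines "J \<equiv> bipartite_ideal"
  shows "hilbert_series (mpol_ring vars Quot J) (a_r_coset (mpol_ring vars) J ` range mpol_const)
      (\<lambda>d. a_r_coset (mpol_ring vars) J ` homogeneous_part vars d)
    = segre_series (m * n1 - 1) 0 + segre_series (m * n2 - 1) 0 + segre_series (m - 1) (n1 + n2 - 1)
      - segre_series (m - 1) (n1 - 1) - segre_series (m - 1) (n2 - 1)"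
proof (rule fps_ext)
  fix d
  have "finite vars" by (simp add: matrix_vars_def)
  from finite_monomials[OF this]
  have "hilbert_function (mpol_ring vars Quot J) (a_r_coset (mpol_ring vars) J ` range mpol_const)
      (\<lambda>d. a_r_coset (mpol_ring vars) J ` homogeneous_part vars d) d
    = card (margin_class left_cols right_cols ` monomials vars d)"
    unfolding J_def monomials_def
    by (intro hilbert_function_eq_card ideal_bipartite_ideal mem_bipartite_ideal_iff)
  moreover have "int (card (margin_class left_cols right_cols ` monomials vars d))
      = int ((m * n1 - 1 + d) choose d) + int ((m * n2 - 1 + d) choose d)
        + int (((m - 1 + d) choose d) * ((n1 + n2 - 1 + d) choose d))
        - int (((m - 1 + d) choose d) * ((n1 - 1 + d) choose d))
        - int (((m - 1 + d) choose d) * ((n2 - 1 + d) choose d))"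
    using arg_cong[OF card_bipartite_classes[of d], of int] by (simp only: of_nat_add of_nat_mult distrib_left)
  ultimately show "fps_nth (hilbert_series (mpol_ring vars Quot J) (a_r_coset (mpol_ring vars) J ` range mpol_const)
      (\<lambda>d. a_r_coset (mpol_ring vars) J ` homogeneous_part vars d)) d
    = fps_nth (segre_series (m * n1 - 1) 0 + segre_series (m * n2 - 1) 0 + segre_series (m - 1) (n1 + n2 - 1)
      - segre_series (m - 1) (n1 - 1) - segre_series (m - 1) (n2 - 1)) d"
    by (simp add: hilbert_series_def segre_series_def)
qed

end

section \<open>Multiplicity\<close>

text \<open>If the pole order \<open>p + q + 1\<close> is below \<open>D\<close>, the surplus
  factors \<open>1 - t\<close> remain in the numerator.\<close>

lemma segre_series_times_power:
  assumes "p + q + 1 \<le> D"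
  shows "segre_series p q * (1 - fps_X) ^ D
    = fps_of_poly (segre_numerator p q * [:1, -1:] ^ (D - (p + q + 1)))"
proof -
  have "fps_of_poly ([:1, -1:] :: int poly) = 1 - fps_X"
    by (simp add: fps_of_poly_pCons)
  moreover have "(1 - fps_X :: int fps) ^ D = (1 - fps_X) ^ (p + q + 1) * (1 - fps_X) ^ (D - (p + q + 1))"
    using assms by (simp only: power_add[symmetric] le_add_diff_inverse)
  ultimately show ?thesis
    unfolding fps_of_poly_mult fps_of_poly_power segre_series_rational[symmetric]
    by (simp only: mult.assoc)
qed

text \<open>A surplus factor vanishes at 1, and \<open>0 ^ 0 = 1\<close> keeps exactly the terms of
  full pole order.\<close>

lemma poly_segre_numerator_power:
  "p + q + 1 \<le> D \<Longrightarrow> poly (segre_numerator p q * [:1, -1:] ^ (D - (p + q + 1))) 1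
    = (if D = p + q + 1 then int (\<Sum>k\<le>p. (p choose k) * (q choose k)) else 0)"
  by (simp add: poly_power poly_segre_numerator_1 power_0_left)

text \<open>The Krull dimension fixes \<open>d\<close>, and a polynomial is determined by its power
  series, so the description is unique.\<close>

lemma graded_multiplicity_eqI:
  assumes "krull_dim A = enat d" "hilbert_series A K G * (1 - fps_X) ^ d = fps_of_poly h"
  shows "graded_multiplicity A K G = poly h 1"
  unfolding graded_multiplicity_def
  using assms by (intro the_equality) (auto simp: fps_of_poly_eq_iff)

lemma sum_choose_zero: "(\<Sum>k\<le>p. (p choose k) * (0 choose k)) = 1"
proof -
  have "(\<Sum>k\<le>p. (p choose k) * (0 choose k)) = (\<Sum>k\<in>{0}. (p choose k) * (0 choose k))"
    by (rule sum.mono_neutral_right) (auto simp: binomial_eq_0)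
  then show ?thesis by simp
qed

lemma quotient_multiplicity_bipartite:
  fixes m n1 n2 :: nat
  assumes "1 \<le> m" "1 \<le> n1" "n1 \<le> n2"
  defines "D \<equiv> max (m * n2) (m + n1 + n2 - 1)"
  shows "quotient_multiplicity (matrix_vars m (n1 + n2))
      (gen_binomial_edge_ideal m (n1 + n2) (complete_bipartite_edges n1 n2) :: (nat \<times> nat, 'k::field) mpol set)
    = (if D = m * n1 then 1 else 0) + (if D = m * n2 then 1 else 0)
      + (if D = m + n1 + n2 - 1 then int (\<Sum>k\<le>m - 1. ((m - 1) choose k) * ((n1 + n2 - 1) choose k)) else 0)"
proof -
  define num where "num p q = segre_numerator p q * [:1, -1:] ^ (D - (p + q + 1))" for p q
  define val where "val p q = (if D = p + q + 1 then int (\<Sum>k\<le>p. (p choose k) * (q choose k)) else 0)" for p q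
  have n2: "1 \<le> n2" using assms by simp
  have pos: "m * n1 - 1 + 0 + 1 = m * n1" "m * n2 - 1 + 0 + 1 = m * n2" "m - 1 + (n1 + n2 - 1) + 1 = m + n1 + n2 - 1"
    "m - 1 + (n1 - 1) + 1 = m + n1 - 1" "m - 1 + (n2 - 1) + 1 = m + n2 - 1"
    using assms n2 by simp_all
  have le: "m * n1 - 1 + 0 + 1 \<le> D" "m * n2 - 1 + 0 + 1 \<le> D" "m - 1 + (n1 + n2 - 1) + 1 \<le> D"
    "m - 1 + (n1 - 1) + 1 \<le> D" "m - 1 + (n2 - 1) + 1 \<le> D"
    unfolding pos using assms(3) by (auto simp: D_def le_max_iff_disj)
  note series = segre_series_times_power[of _ _ D, folded num_def]
  note eval = poly_segre_numerator_power[of _ _ D, folded num_def val_def]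
  let ?h = "num (m * n1 - 1) 0 + num (m * n2 - 1) 0 + num (m - 1) (n1 + n2 - 1) - num (m - 1) (n1 - 1) - num (m - 1) (n2 - 1)"
  have "quotient_multiplicity (matrix_vars m (n1 + n2))
      (gen_binomial_edge_ideal m (n1 + n2) (complete_bipartite_edges n1 n2) :: (nat \<times> nat, 'k::field) mpol set) = poly ?h 1"
    unfolding quotient_multiplicity_def
    by (rule graded_multiplicity_eqI[OF krull_dim_bipartite[OF assms(1,2) n2 assms(3), folded D_def]])
       (simp only: hilbert_series_bipartite[OF assms(1,2) n2] left_diff_distrib distrib_right series le
         fps_of_poly_add fps_of_poly_diff)
  also have "\<dots> = val (m * n1 - 1) 0 + val (m * n2 - 1) 0 + val (m - 1) (n1 + n2 - 1) - val (m - 1) (n1 - 1) - val (m - 1) (n2 - 1)"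
    by (simp only: poly_add poly_diff eval le)
  also have "\<dots> = (if D = m * n1 then 1 else 0) + (if D = m * n2 then 1 else 0)
      + (if D = m + n1 + n2 - 1 then int (\<Sum>k\<le>m - 1. ((m - 1) choose k) * ((n1 + n2 - 1) choose k)) else 0)"
  proof -
    \<comment> \<open>Both parts are nonempty, so the subtracted terms have pole order below
      \<open>D\<close>.\<close>
    have "D \<noteq> m + n1 - 1" "D \<noteq> m + n2 - 1" using assms n2 by (auto simp: D_def)
    then show ?thesis by (simp only: val_def pos sum_choose_zero) simp
  qed
  finally show ?thesis .
qed

theorem corollary3p11:
  fixes m n1 n2 :: nat
  assumes "m \<ge> 2" and "1 \<le> n1" and "n1 \<le> n2" and "n2 \<ge> 2"
  shows
    "let J = (gen_binomial_edge_ideal m (n1 + n2) (complete_bipartite_edges n1 n2)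
                :: (nat \<times> nat, 'k::field) mpol set);
         e = quotient_multiplicity (matrix_vars m (n1 + n2)) J
     in (max (m + n1 + n2 - 1) (m * n1) < m * n2 \<longrightarrow> e = 1) \<and>
        (m + n1 + n2 - 1 < m * n1 \<and> m * n1 = m * n2 \<longrightarrow> e = 2) \<and>
        (m * n2 < m + n1 + n2 - 1 \<longrightarrow> e = 2 * int n2) \<and>
        (m + n1 + n2 - 1 = m * n1 \<and> m * n1 = m * n2 \<longrightarrow> e = 12) \<and>
        (m * n1 < m + n1 + n2 - 1 \<and> m + n1 + n2 - 1 = m * n2 \<longrightarrow>
           e = int (Sum_any (\<lambda>k. ((m - 1) choose k) * ((n1 + n2 - 1) choose k)) + 1))"
proof -
  let ?J = "gen_binomial_edge_ideal m (n1 + n2) (complete_bipartite_edges n1 n2) :: (nat \<times> nat, 'k) mpol set"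
  let ?r = "m + n1 + n2 - 1"
  define e where "e = quotient_multiplicity (matrix_vars m (n1 + n2)) ?J"
  define s where "s = (\<Sum>k\<le>m - 1. ((m - 1) choose k) * ((n1 + n2 - 1) choose k))"
  have e: "e = (if max (m * n2) ?r = m * n1 then 1 else 0) + (if max (m * n2) ?r = m * n2 then 1 else 0)
      + (if max (m * n2) ?r = ?r then int s else 0)"
    unfolding e_def s_def using assms by (intro quotient_multiplicity_bipartite) simp_all
  have le: "m * n1 \<le> m * n2" using assms by simp
  have c3: "e = 2 * int n2" if less: "m * n2 < ?r"
  proof -
    \<comment> \<open>For \<open>m = 3 + k\<close> and \<open>n2 >= 2\<close> the product
      \<open>m * n2\<close> is at least \<open>3 * n2 + 2 * k\<close>, while \<open>?r\<close> is at
      most \<open>2 * n2 + k + 2\<close>.\<close>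
    have "m = 2"
    proof (rule ccontr)
      assume "m \<noteq> 2"
      then obtain k where k: "m = 3 + k" using assms(1) by (metis add.commute le_Suc_ex le_antisym not_less_eq_eq numeral_2_eq_2 numeral_3_eq_3)
      have "k * 2 \<le> k * n2" using assms(4) by (rule mult_le_mono2)
      then show False using less assms unfolding k distrib_right by linarith
    qed
    then have "n1 = n2" using less assms by simp
    \<comment> \<open>Only \<open>k = 0\<close> and \<open>k = 1\<close> contribute:
      \<open>1 + (2 * n2 - 1)\<close>.\<close>
    have "s = 2 * n2"
      using \<open>m = 2\<close> \<open>n1 = n2\<close> assms by (simp add: s_def)
    moreover have "max (m * n2) ?r = ?r" "?r \<noteq> m * n1" "?r \<noteq> m * n2"
      using less le by linarith+
    ultimately show ?thesis using e by (simp only: if_True if_False) simp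
  qed
  have c4: "e = 12" if eq: "?r = m * n1" "m * n1 = m * n2"
  proof -
    have "n1 = n2" using eq(2) assms by simp
    obtain k l where kl: "m = 2 + k" "n2 = 2 + l" using assms by (metis le_Suc_ex)
    \<comment> \<open>The equality of dimensions reads \<open>(m - 2) * (n2 - 1) = 1\<close>, which
      leaves a single triple.\<close>
    have "k * l + k = 1"
      using eq \<open>n1 = n2\<close> by (simp add: kl algebra_simps)
    then have "k = 1 \<and> l = 0" by (cases k; cases l) auto
    then have mn: "m = 3" "n1 = 2" "n2 = 2" using kl \<open>n1 = n2\<close> by auto
    \<comment> \<open>\<open>1 + 2 * 3 + 1 * 3\<close>; the two linear pieces add one each, giving
      12.\<close>
    have "s = 10" by (simp add: s_def mn numeral_eq_Suc)
    then show ?thesis using e by (simp add: mn)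
  qed
  have c5: "e = int (Sum_any (\<lambda>k. ((m - 1) choose k) * ((n1 + n2 - 1) choose k)) + 1)"
    if "m * n1 < ?r" "?r = m * n2"
  proof -
    \<comment> \<open>The first binomial vanishes beyond \<open>m - 1\<close>, so the unbounded sum
      is finite.\<close>
    have "Sum_any (\<lambda>k. ((m - 1) choose k) * ((n1 + n2 - 1) choose k)) = s"
      unfolding s_def by (rule Sum_any.expand_superset) (auto simp: not_le[symmetric] intro: ccontr)
    then show ?thesis using e that by simp
  qed
  have "e = 1" if "max ?r (m * n1) < m * n2"
  proof -
    have "max (m * n2) ?r = m * n2" "m * n2 \<noteq> m * n1" "m * n2 \<noteq> ?r" using that by linarith+
    then show ?thesis using e by (simp only: if_True if_False) simp
  qed
  moreover have "e = 2" if "?r < m * n1" "m * n1 = m * n2"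
  proof -
    have "max (m * n2) ?r = m * n2" "m * n2 = m * n1" "m * n2 \<noteq> ?r" using that by linarith+
    then show ?thesis using e by (simp only: if_True if_False) simp
  qed
  ultimately show ?thesis
    using c3 c4 c5 unfolding Let_def e_def[symmetric] by blast
qed

end
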